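(* Let $A\in\mathfrak{her}_N$ and let $P=(P_1,\dots,P_r)\in\mathrm{Gr}^{\times r}(\mathbf m,\mathbf n)$ be a local maximizer (respectively, local minimizer) of $\rho_A$. If the Riemannian Hessian $\mathbf H_{\rho_A}(P)$ is non-degenerate, then for all $j=1,\dots,r$ $$\sigma(\Psi_j')\cap\sigma(\Psi_j'')=\emptyset,$$ where $\sigma(X)$ denotes the spectrum of $X$ and $\Psi_j'\in\mathfrak{her}_{m_j}$, $\Psi_j''\in\mathfrak{her}_{n_j-m_j}$ are the diagonal blocks of $\Theta_j^\dagger\widehat A_j\Theta_j$ defined in the context.
   Context: Let $r\ge 1$, $1\le m_j\le n_j$ be integers for $j=1,\dots,r$, $N:=n_1\cdots n_r$, $(\mathbf m,\mathbf n):=((m_1,n_1),\dots,(m_r,n_r))$. $\mathfrak{her}_n$ is the real vector space of Hermitian $n\times n$ complex matrices. $\mathrm{Gr}_{m,n}:=\{P\in\mathbb{C}^{n\times n}\mid P=P^\dagger=P^2,\ \operatorname{tr}P=m\}$, a smooth submanifold of $\mathfrak{her}_n$, and $\mathrm{Gr}^{\times r}(\mathbf m,\mathbf n):=\mathrm{Gr}_{m_1,n_1}\times\cdots\times\mathrm{Gr}_{m_r,n_r}\subset\mathfrak{her}_{n_1}\times\cdots\times\mathfrak{her}_{n_r}$, with the Riemannian metric induced by $\langle (X_j),(Y_j)\rangle=\sum_j\operatorname{tr}(X_jY_j)$. The generalized Rayleigh-quotient is $\rho_A:\mathrm{Gr}^{\times r}(\mathbf m,\mathbf n)\to\mathbb{R}$,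 $\rho_A(P_1,\dots,P_r)=\operatorname{tr}(A(P_1\otimes\cdots\otimes P_r))$, with $\otimes$ the Kronecker product. The Riemannian Hessian is $\mathbf H_{\rho_A}(P)\xi=\boldsymbol\nabla_\xi\operatorname{grad}\rho_A(P)$ ($\boldsymbol\nabla$ the Levi-Civita connection), a linear operator on $\mathrm T_P\mathrm{Gr}^{\times r}(\mathbf m,\mathbf n)$; non-degenerate means invertible. $\widehat A_j$ is the unique $n_j\times n_j$ matrix (it is Hermitian) such that $\operatorname{tr}\big(A(P_1\otimes\cdots\otimes P_{j-1}\otimes Z\otimes P_{j+1}\otimes\cdots\otimes P_r)\big)=\operatorname{tr}(\widehat A_jZ)$ for all $Z\in\mathbb{C}^{n_j\times n_j}$. $\Theta_j\in\mathrm{SU}_{n_j}$ is any special unitary matrix with $\Theta_j^\dagger P_j\Theta_j=\Pi_j:=\begin{bmatrix}I_{m_j}&0\\0&0\end{bmatrix}$, and one writes $$\Theta_j^\dagger\widehat A_j\Theta_j=\begin{bmatrix}\Psi_j'&\Psi_j'''\\ \Psi_j'''^\dagger&\Psi_j''\end{bmatrix},\quad \Psi_j'\in\mathfrak{her}_{m_j},\ \Psi_j''\in\mathfrak{her}_{n_j-m_j},\ \Psi_j'''\in\mathbb{C}^{m_j\times(n_j-m_j)}.$$ *)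

theory Defs
  imports
    Complex_Main
    "Jordan_Normal_Form.Schur_Decomposition"
    "Jordan_Normal_Form.Spectral_Radius"
begin

section \<open>Matrices\<close>

definition mtrace :: "complex mat \<Rightarrow> complex" where
  "mtrace X = (\<Sum>i<dim_row X. X $$ (i, i))"

definition her :: "nat \<Rightarrow> complex mat set" where
  "her n = {X \<in> carrier_mat n n. mat_adjoint X = X}"

definition SU :: "nat \<Rightarrow> complex mat set" where
  "SU n = {U \<in> carrier_mat n n. mat_adjoint U * U = 1\<^sub>m n \<and> U * mat_adjoint U = 1\<^sub>m n
            \<and> Determinant.det U = 1}"

definition kron :: "complex mat \<Rightarrow> complex mat \<Rightarrow> complex mat" where
  "kron X Y = mat (dim_row X * dim_row Y) (dim_col X * dim_col Y)
     (\<lambda>(i, k). X $$ (i div dim_row Y, k div dim_col Y) * Y $$ (i mod dim_row Y, k mod dim_col Y))"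

definition kron_list :: "complex mat list \<Rightarrow> complex mat" where
  "kron_list Xs = foldr kron Xs (1\<^sub>m 1)"

definition std_proj :: "nat \<Rightarrow> nat \<Rightarrow> complex mat" where
  "std_proj m n = four_block_mat (1\<^sub>m m) (0\<^sub>m m (n - m)) (0\<^sub>m (n - m) m) (0\<^sub>m (n - m) (n - m))"


section \<open>The Euclidean space of tuples of Hermitian matrices\<close>

text \<open>
  A tuple of matrices is a list, with positions counted from 0. The list \<open>ns\<close> of sizes
  determines the space \<open>her_prod ns\<close>, the product of the spaces of Hermitian matrices of
  sizes \<open>ns ! 0\<close>, \<open>ns ! 1\<close>, and so on. It is a finite-dimensional real vector space.
\<close>

type_synonym tuple = "complex mat list"

definition her_prod :: "nat list \<Rightarrow> tuple set" where
  "her_prod ns = {X. length X = length ns \<and> (\<forall>j<length ns. X ! j \<in> her (ns ! j))}"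

definition tadd :: "tuple \<Rightarrow> tuple \<Rightarrow> tuple" where
  "tadd X Y = map2 (+) X Y"

definition tscale :: "real \<Rightarrow> tuple \<Rightarrow> tuple" where
  "tscale a X = map (\<lambda>Z. complex_of_real a \<cdot>\<^sub>m Z) X"

text \<open>The traces below are real for Hermitian arguments, so taking real parts loses nothing.\<close>

definition tinner :: "tuple \<Rightarrow> tuple \<Rightarrow> real" where
  "tinner X Y = (\<Sum>j<length X. Re (mtrace (X ! j * Y ! j)))"

definition tdist :: "tuple \<Rightarrow> tuple \<Rightarrow> real" where
  "tdist X Y = (let D = tadd X (tscale (- 1) Y) in sqrt (tinner D D))"

definition tball :: "nat list \<Rightarrow> tuple \<Rightarrow> real \<Rightarrow> tuple set" where
  "tball ns P e = {X \<in> her_prod ns. tdist P X < e}"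

definition tcontinuous_on :: "tuple set \<Rightarrow> (tuple \<Rightarrow> real) \<Rightarrow> bool" where
  "tcontinuous_on U f \<longleftrightarrow>
     (\<forall>X\<in>U. \<forall>e>0. \<exists>d>0. \<forall>Y\<in>U. tdist X Y < d \<longrightarrow> \<bar>f Y - f X\<bar> < e)"

text \<open>
  \<open>Ck_on ns k U f\<close>: on the relatively open subset \<open>U\<close> of \<open>her_prod ns\<close>, all iterated
  directional derivatives of \<open>f\<close> of order at most \<open>k\<close> exist and are continuous.
\<close>

primrec Ck_on :: "nat list \<Rightarrow> nat \<Rightarrow> tuple set \<Rightarrow> (tuple \<Rightarrow> real) \<Rightarrow> bool" where
  "Ck_on ns 0 U f \<longleftrightarrow> tcontinuous_on U f"
| "Ck_on ns (Suc k) U f \<longleftrightarrow> tcontinuous_on U f \<and>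
     (\<forall>V\<in>her_prod ns. \<exists>g.
        (\<forall>X\<in>U. ((\<lambda>t. f (tadd X (tscale t V))) has_real_derivative g X) (at 0)) \<and>
        Ck_on ns k U g)"

definition smooth_on :: "nat list \<Rightarrow> tuple set \<Rightarrow> (tuple \<Rightarrow> real) \<Rightarrow> bool" where
  "smooth_on ns U f \<longleftrightarrow> (\<forall>k. Ck_on ns k U f)"

definition curve_deriv :: "nat list \<Rightarrow> (real \<Rightarrow> tuple) \<Rightarrow> real \<Rightarrow> tuple \<Rightarrow> bool" where
  "curve_deriv ns c t \<xi> \<longleftrightarrow> \<xi> \<in> her_prod ns \<and>
     (\<forall>j<length ns. \<forall>i<ns ! j. \<forall>k<ns ! j.
        ((\<lambda>s. (c s ! j) $$ (i, k)) has_vector_derivative (\<xi> ! j) $$ (i, k)) (at t))"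


section \<open>Riemannian geometry of submanifolds\<close>

text \<open>
  Throughout, \<open>M\<close> is an embedded smooth submanifold of \<open>her_prod ns\<close> with the Riemannian
  metric obtained by restricting \<^term>\<open>tinner\<close> to its tangent spaces. Functions and vector
  fields on \<open>M\<close> are total functions whose values outside \<open>M\<close> are irrelevant.
\<close>

text \<open>In the next definition \<open>g k\<close> is the \<open>k\<close>-th derivative of \<open>c\<close>.\<close>

definition smooth_curve :: "nat list \<Rightarrow> tuple set \<Rightarrow> (real \<Rightarrow> tuple) \<Rightarrow> bool" where
  "smooth_curve ns M c \<longleftrightarrow> (\<forall>t. c t \<in> M) \<and>
     (\<exists>g :: nat \<Rightarrow> real \<Rightarrow> tuple. g 0 = c \<and> (\<forall>k t. curve_deriv ns (g k) t (g (Suc k) t)))"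

definition curve_through :: "nat list \<Rightarrow> tuple set \<Rightarrow> tuple \<Rightarrow> tuple \<Rightarrow> (real \<Rightarrow> tuple) \<Rightarrow> bool" where
  "curve_through ns M p \<xi> c \<longleftrightarrow> smooth_curve ns M c \<and> c 0 = p \<and> curve_deriv ns c 0 \<xi>"

definition tangent_space :: "nat list \<Rightarrow> tuple set \<Rightarrow> tuple \<Rightarrow> tuple set" where
  "tangent_space ns M p = {\<xi>. \<exists>c. curve_through ns M p \<xi> c}"

definition smooth_fun :: "nat list \<Rightarrow> tuple set \<Rightarrow> (tuple \<Rightarrow> real) \<Rightarrow> bool" where
  "smooth_fun ns M f \<longleftrightarrow>
     (\<forall>p\<in>M. \<exists>e>0. \<exists>g. smooth_on ns (tball ns p e) g \<and> (\<forall>q\<in>M \<inter> tball ns p e. g q = f q))"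

definition tangent_deriv :: "nat list \<Rightarrow> tuple set \<Rightarrow> (tuple \<Rightarrow> real) \<Rightarrow> tuple \<Rightarrow> tuple \<Rightarrow> real" where
  "tangent_deriv ns M f p \<xi> =
     (THE d. \<forall>c. curve_through ns M p \<xi> c \<longrightarrow> ((\<lambda>t. f (c t)) has_real_derivative d) (at 0))"

definition vector_fields :: "nat list \<Rightarrow> tuple set \<Rightarrow> (tuple \<Rightarrow> tuple) set" where
  "vector_fields ns M = {Y. (\<forall>p\<in>M. Y p \<in> tangent_space ns M p) \<and>
     (\<forall>V\<in>her_prod ns. smooth_fun ns M (\<lambda>p. tinner (Y p) V))}"

text \<open>
  \<open>nabla p \<xi> Y\<close> is the covariant derivative at \<open>p\<close> of the vector field \<open>Y\<close> in the direction of
  the tangent vector \<open>\<xi>\<close>.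
\<close>

definition affine_connection ::
    "nat list \<Rightarrow> tuple set \<Rightarrow> (tuple \<Rightarrow> tuple \<Rightarrow> (tuple \<Rightarrow> tuple) \<Rightarrow> tuple) \<Rightarrow> bool" where
  "affine_connection ns M nabla \<longleftrightarrow>
     (\<forall>p\<in>M. \<forall>\<xi>\<in>tangent_space ns M p. \<forall>Y\<in>vector_fields ns M.
        nabla p \<xi> Y \<in> tangent_space ns M p) \<and>
     (\<forall>X\<in>vector_fields ns M. \<forall>Y\<in>vector_fields ns M.
        (\<lambda>p. nabla p (X p) Y) \<in> vector_fields ns M) \<and>
     (\<forall>p\<in>M. \<forall>\<xi>\<in>tangent_space ns M p. \<forall>\<eta>\<in>tangent_space ns M p. \<forall>a b. \<forall>Y\<in>vector_fields ns M.
        nabla p (tadd (tscale a \<xi>) (tscale b \<eta>)) Y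
          = tadd (tscale a (nabla p \<xi> Y)) (tscale b (nabla p \<eta> Y))) \<and>
     (\<forall>p\<in>M. \<forall>\<xi>\<in>tangent_space ns M p. \<forall>Y\<in>vector_fields ns M. \<forall>Z\<in>vector_fields ns M.
        nabla p \<xi> (\<lambda>q. tadd (Y q) (Z q)) = tadd (nabla p \<xi> Y) (nabla p \<xi> Z)) \<and>
     (\<forall>p\<in>M. \<forall>\<xi>\<in>tangent_space ns M p. \<forall>Y\<in>vector_fields ns M. \<forall>f. smooth_fun ns M f \<longrightarrow>
        nabla p \<xi> (\<lambda>q. tscale (f q) (Y q))
          = tadd (tscale (tangent_deriv ns M f p \<xi>) (Y p)) (tscale (f p) (nabla p \<xi> Y)))"

text \<open>
  Vanishing torsion, \<open>\<nabla>\<^bsub>X\<^esub> Y - \<nabla>\<^bsub>Y\<^esub> X = [X, Y]\<close>, is stated through the action of both sides as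
  derivations on smooth functions \<open>f\<close>, where \<open>[X, Y] f = X (Y f) - Y (X f)\<close>.
\<close>

definition torsion_free ::
    "nat list \<Rightarrow> tuple set \<Rightarrow> (tuple \<Rightarrow> tuple \<Rightarrow> (tuple \<Rightarrow> tuple) \<Rightarrow> tuple) \<Rightarrow> bool" where
  "torsion_free ns M nabla \<longleftrightarrow>
     (\<forall>X\<in>vector_fields ns M. \<forall>Y\<in>vector_fields ns M. \<forall>f. smooth_fun ns M f \<longrightarrow> (\<forall>p\<in>M.
        tangent_deriv ns M f p (nabla p (X p) Y) - tangent_deriv ns M f p (nabla p (Y p) X)
          = tangent_deriv ns M (\<lambda>q. tangent_deriv ns M f q (Y q)) p (X p)
            - tangent_deriv ns M (\<lambda>q. tangent_deriv ns M f q (X q)) p (Y p)))"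

definition metric_compatible ::
    "nat list \<Rightarrow> tuple set \<Rightarrow> (tuple \<Rightarrow> tuple \<Rightarrow> (tuple \<Rightarrow> tuple) \<Rightarrow> tuple) \<Rightarrow> bool" where
  "metric_compatible ns M nabla \<longleftrightarrow>
     (\<forall>p\<in>M. \<forall>\<xi>\<in>tangent_space ns M p. \<forall>Y\<in>vector_fields ns M. \<forall>Z\<in>vector_fields ns M.
        tangent_deriv ns M (\<lambda>q. tinner (Y q) (Z q)) p \<xi>
          = tinner (nabla p \<xi> Y) (Z p) + tinner (Y p) (nabla p \<xi> Z))"

text \<open>
  By the fundamental theorem of Riemannian geometry there is such a \<open>nabla\<close>, and its values
  \<open>nabla p \<xi> Y\<close> at points \<open>p\<close> of \<open>M\<close>, tangent vectors \<open>\<xi>\<close> at \<open>p\<close> and vector fields \<open>Y\<close> are unique.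
\<close>

definition levi_civita ::
    "nat list \<Rightarrow> tuple set \<Rightarrow> (tuple \<Rightarrow> tuple \<Rightarrow> (tuple \<Rightarrow> tuple) \<Rightarrow> tuple) \<Rightarrow> bool" where
  "levi_civita ns M nabla \<longleftrightarrow>
     affine_connection ns M nabla \<and> torsion_free ns M nabla \<and> metric_compatible ns M nabla"

definition rgrad :: "nat list \<Rightarrow> tuple set \<Rightarrow> (tuple \<Rightarrow> real) \<Rightarrow> tuple \<Rightarrow> tuple" where
  "rgrad ns M f p = (THE v. v \<in> tangent_space ns M p \<and>
     (\<forall>\<xi>\<in>tangent_space ns M p. tinner v \<xi> = tangent_deriv ns M f p \<xi>))"

definition rhess ::
    "nat list \<Rightarrow> tuple set \<Rightarrow> (tuple \<Rightarrow> tuple \<Rightarrow> (tuple \<Rightarrow> tuple) \<Rightarrow> tuple)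
      \<Rightarrow> (tuple \<Rightarrow> real) \<Rightarrow> tuple \<Rightarrow> tuple \<Rightarrow> tuple" where
  "rhess ns M nabla f p \<xi> = nabla p \<xi> (rgrad ns M f)"

definition nondegenerate_at :: "nat list \<Rightarrow> tuple set \<Rightarrow> tuple \<Rightarrow> (tuple \<Rightarrow> tuple) \<Rightarrow> bool" where
  "nondegenerate_at ns M p H \<longleftrightarrow> bij_betw H (tangent_space ns M p) (tangent_space ns M p)"

definition local_maximizer :: "tuple set \<Rightarrow> (tuple \<Rightarrow> real) \<Rightarrow> tuple \<Rightarrow> bool" where
  "local_maximizer M f p \<longleftrightarrow> p \<in> M \<and> (\<exists>e>0. \<forall>q\<in>M. tdist p q < e \<longrightarrow> f q \<le> f p)"

definition local_minimizer :: "tuple set \<Rightarrow> (tuple \<Rightarrow> real) \<Rightarrow> tuple \<Rightarrow> bool" where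
  "local_minimizer M f p \<longleftrightarrow> p \<in> M \<and> (\<exists>e>0. \<forall>q\<in>M. tdist p q < e \<longrightarrow> f p \<le> f q)"


section \<open>Products of Grassmannians and the generalized Rayleigh-quotient\<close>

definition Gr :: "nat \<Rightarrow> nat \<Rightarrow> complex mat set" where
  "Gr m n = {P \<in> carrier_mat n n. P = mat_adjoint P \<and> P = P * P \<and> mtrace P = of_nat m}"

definition Gr_prod :: "nat list \<Rightarrow> nat list \<Rightarrow> tuple set" where
  "Gr_prod ms ns = {P. length P = length ns \<and> (\<forall>j<length ns. P ! j \<in> Gr (ms ! j) (ns ! j))}"

definition rayleigh :: "complex mat \<Rightarrow> tuple \<Rightarrow> real" where
  "rayleigh A P = Re (mtrace (A * kron_list P))"

definition Ahat :: "nat list \<Rightarrow> complex mat \<Rightarrow> tuple \<Rightarrow> nat \<Rightarrow> complex mat" where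
  "Ahat ns A P j = (THE B. B \<in> carrier_mat (ns ! j) (ns ! j) \<and>
     (\<forall>Z\<in>carrier_mat (ns ! j) (ns ! j). mtrace (A * kron_list (P[j := Z])) = mtrace (B * Z)))"

end

theory Submission
  imports Defs
begin

text \<open>
  Suppose that \<open>\<Psi>'\<close> and \<open>\<Psi>''\<close> have a common eigenvalue \<open>\<lambda>\<close>, with eigenvectors \<open>x\<close> and \<open>y\<close>. Rotating
  the range of \<open>P\<^sub>j\<close> in the plane spanned by \<open>\<Theta> (x, 0)\<close> and \<open>\<Theta> (0, y)\<close> moves \<open>P\<close> along a curve in the
  manifold, and since the Rayleigh-quotient depends on the slot \<open>j\<close> through a trace against
  \<open>Ahat ns A P j\<close> only, its second derivative at \<open>P\<close> along this curve is a multiple of the difference of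
  the Rayleigh-quotients of \<open>\<Psi>''\<close> at \<open>y\<close> and of \<open>\<Psi>'\<close> at \<open>x\<close>, that is, of \<open>\<lambda> - \<lambda> = 0\<close>. The velocity \<open>V \<noteq> 0\<close> is therefore isotropic for the Hessian. At a local
  extremum the Hessian is a symmetric semidefinite form, hence an isotropic vector lies in its
  kernel, which contradicts non-degeneracy.

  To carry this out for an arbitrary Levi-Civita connection, the Hessian is computed against
  Killing fields. The tangent space at \<open>P\<close> consists of the Hermitian tuples with
  \<open>V\<^sub>j = P\<^sub>j V\<^sub>j + V\<^sub>j P\<^sub>j\<close> (\<open>tangent_space_Gr\<close>). Each such \<open>V\<close> is the value at \<open>P\<close> of the field
  \<open>Q \<mapsto> [\<Omega>, Q]\<close> with the skew-Hermitian \<open>\<Omega> = [V, P]\<close>, and the integral curves of this field, the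
  orbits of \<open>exp (t \<Omega>)\<close> under conjugation, stay in the manifold (\<open>Gr_curve\<close>). At a
  critical point, metric compatibility expresses the Hessian by derivatives of the Rayleigh-quotient
  along Killing fields (\<open>hessian_eq\<close>). Vanishing torsion yields symmetry (\<open>hessian_symmetric\<close>), the
  second derivative test along integral curves yields the sign (\<open>rayleigh_diff_critical\<close>), and both
  together yield the kernel statement (\<open>hessian_kernel\<close>). The isotropic vector comes
  from \<open>isotropic_direction\<close> and \<open>hessian_isotropic\<close>.

  The axioms of a connection apply to smooth vector fields only. Smoothness of the gradient and of
  Killing fields is deduced from their components being polynomials in the matrix entries
  (\<open>polyfun_Ck_on\<close>). For the gradient this rests on an explicit formula for the trace against a
  Kronecker product (\<open>kron_trace_eq\<close>).
\<close>

section \<open>Hermitian matrices, traces and commutators\<close>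

lemma mat_adjoint_carrier [simp]:
  fixes X :: "complex mat" assumes "X \<in> carrier_mat n m" shows "mat_adjoint X \<in> carrier_mat m n"
  using assms by (auto simp: mat_adjoint_def)

lemma mat_adjoint_dim [simp]:
  fixes X :: "complex mat"
  shows "dim_row (mat_adjoint X) = dim_col X" "dim_col (mat_adjoint X) = dim_row X"
  by (auto simp: mat_adjoint_def)

lemma mat_adjoint_index [simp]:
  fixes X :: "complex mat" assumes "i < dim_col X" "k < dim_row X"
  shows "mat_adjoint X $$ (i, k) = cnj (X $$ (k, i))"
  using assms unfolding mat_adjoint_def mat_of_rows_def by simp

lemma mat_adjoint_mult:
  fixes X Y :: "complex mat" assumes "X \<in> carrier_mat n m" "Y \<in> carrier_mat m l"
  shows "mat_adjoint (X * Y) = mat_adjoint Y * mat_adjoint X"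
  using assms by (intro eq_matI) (auto simp: scalar_prod_def mult.commute)

lemma mat_adjoint_add:
  fixes X Y :: "complex mat" assumes "X \<in> carrier_mat n m" "Y \<in> carrier_mat n m"
  shows "mat_adjoint (X + Y) = mat_adjoint X + mat_adjoint Y"
  using assms by (intro eq_matI) auto

lemma mat_adjoint_minus:
  fixes X Y :: "complex mat" assumes "X \<in> carrier_mat n m" "Y \<in> carrier_mat n m"
  shows "mat_adjoint (X - Y) = mat_adjoint X - mat_adjoint Y"
  using assms by (intro eq_matI) auto

lemma mat_adjoint_smult:
  fixes X :: "complex mat"
  shows "mat_adjoint (a \<cdot>\<^sub>m X) = cnj a \<cdot>\<^sub>m mat_adjoint X"
  by (intro eq_matI) auto

lemma mat_adjoint_mat_adjoint [simp]:
  fixes X :: "complex mat" shows "mat_adjoint (mat_adjoint X) = X"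
  by (intro eq_matI) auto

lemma her_carrier: "X \<in> her n \<Longrightarrow> X \<in> carrier_mat n n"
  by (simp add: her_def)

lemma her_iff_entries:
  "X \<in> her n \<longleftrightarrow> X \<in> carrier_mat n n \<and> (\<forall>i<n. \<forall>k<n. X $$ (i, k) = cnj (X $$ (k, i)))"
proof
  assume "X \<in> her n"
  then have X: "X \<in> carrier_mat n n" "mat_adjoint X = X" by (auto simp: her_def)
  have "X $$ (i, k) = cnj (X $$ (k, i))" if "i < n" "k < n" for i k
  proof -
    have "mat_adjoint X $$ (i, k) = cnj (X $$ (k, i))"
      by (rule mat_adjoint_index) (use X(1) that in auto)
    then show ?thesis unfolding X(2) .
  qed
  with X show "X \<in> carrier_mat n n \<and> (\<forall>i<n. \<forall>k<n. X $$ (i, k) = cnj (X $$ (k, i)))" by blast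
next
  assume "X \<in> carrier_mat n n \<and> (\<forall>i<n. \<forall>k<n. X $$ (i, k) = cnj (X $$ (k, i)))"
  then have X: "X \<in> carrier_mat n n"
    and e: "\<And>i k. i < n \<Longrightarrow> k < n \<Longrightarrow> X $$ (i, k) = cnj (X $$ (k, i))" by blast+
  have "mat_adjoint X = X"
    using X by (intro eq_matI) (auto simp flip: e)
  then show "X \<in> her n" using X by (simp add: her_def)
qed

lemma her_add: "X \<in> her n \<Longrightarrow> Y \<in> her n \<Longrightarrow> X + Y \<in> her n"
  by (auto simp: her_def mat_adjoint_add)

lemma her_smult: "X \<in> her n \<Longrightarrow> complex_of_real a \<cdot>\<^sub>m X \<in> her n"
  by (auto simp: her_def mat_adjoint_smult)

lemma mtrace_add:
  "X \<in> carrier_mat n n \<Longrightarrow> Y \<in> carrier_mat n n \<Longrightarrow> mtrace (X + Y) = mtrace X + mtrace Y"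
  by (auto simp: mtrace_def sum.distrib)

lemma mtrace_minus:
  "X \<in> carrier_mat n n \<Longrightarrow> Y \<in> carrier_mat n n \<Longrightarrow> mtrace (X - Y) = mtrace X - mtrace Y"
  by (auto simp: mtrace_def sum_subtractf)

lemma mtrace_smult: "X \<in> carrier_mat n n \<Longrightarrow> mtrace (a \<cdot>\<^sub>m X) = a * mtrace X"
  by (auto simp: mtrace_def sum_distrib_left)

lemma mtrace_mult:
  assumes "X \<in> carrier_mat n m" "Y \<in> carrier_mat m n"
  shows "mtrace (X * Y) = (\<Sum>i<n. \<Sum>k<m. X $$ (i, k) * Y $$ (k, i))"
  using assms by (auto simp: mtrace_def scalar_prod_def atLeast0LessThan)

lemma mtrace_comm:
  assumes "X \<in> carrier_mat n m" "Y \<in> carrier_mat m n"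
  shows "mtrace (X * Y) = mtrace (Y * X)"
  unfolding mtrace_mult[OF assms] mtrace_mult[OF assms(2,1)]
  by (subst sum.swap) (simp add: mult.commute)

lemma mtrace_adjoint: 
  assumes "X \<in> carrier_mat n n" shows "mtrace (mat_adjoint X) = cnj (mtrace X)"
  using assms by (auto simp: mtrace_def)

text \<open>
  The squared Frobenius norm: the metric is positive definite on Hermitian matrices.
\<close>

lemma trace_her_sq:
  assumes "X \<in> her n"
  shows "mtrace (X * X) = complex_of_real (\<Sum>i<n. \<Sum>k<n. (cmod (X $$ (i, k)))\<^sup>2)"
proof -
  have X: "X \<in> carrier_mat n n" using assms by (rule her_carrier)
  have "X $$ (i, k) * X $$ (k, i) = complex_of_real ((cmod (X $$ (i, k)))\<^sup>2)" if "i < n" "k < n" for i k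
  proof -
    have "X $$ (k, i) = cnj (X $$ (i, k))" using assms that unfolding her_iff_entries by blast
    then show ?thesis by (metis complex_norm_square)
  qed
  then show ?thesis unfolding mtrace_mult[OF X X] by simp
qed

lemma trace_her_sq_eq_0:
  assumes "X \<in> her n" "Re (mtrace (X * X)) = 0"
  shows "X = 0\<^sub>m n n"
proof -
  have s: "(\<Sum>i<n. \<Sum>k<n. (cmod (X $$ (i, k)))\<^sup>2) = 0"
    using assms(2) unfolding trace_her_sq[OF assms(1)] Re_complex_of_real .
  have "X $$ (i, k) = 0" if "i < n" "k < n" for i k
  proof -
    have "(\<Sum>k<n. (cmod (X $$ (i, k)))\<^sup>2) = 0"
      using s that(1) by (subst (asm) sum_nonneg_eq_0_iff) (auto intro: sum_nonneg)
    then have "(cmod (X $$ (i, k)))\<^sup>2 = 0"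
      using that(2) by (subst (asm) sum_nonneg_eq_0_iff) auto
    then show ?thesis by simp
  qed
  then show ?thesis using her_carrier[OF assms(1)] by (intro eq_matI) auto
qed

text \<open>
  Commutators encode everything about the Grassmannian: its tangent space at \<open>P\<close> is the range of
  \<open>\<Omega> \<mapsto> ad \<Omega> P\<close> on skew-Hermitian matrices, and unitary conjugation by \<open>exp (t \<Omega>)\<close>
  is \<open>exp (t (ad \<Omega>))\<close>.
\<close>

definition ad :: "complex mat \<Rightarrow> complex mat \<Rightarrow> complex mat" where
  "ad X Y = X * Y - Y * X"

lemma ad_carrier [simp]: "X \<in> carrier_mat n n \<Longrightarrow> Y \<in> carrier_mat n n \<Longrightarrow> ad X Y \<in> carrier_mat n n"
  by (auto simp: ad_def intro!: minus_carrier_mat mult_carrier_mat)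

lemma ad_index:
  assumes "X \<in> carrier_mat n n" "Y \<in> carrier_mat n n" "i < n" "k < n"
  shows "ad X Y $$ (i, k) = (\<Sum>l<n. X $$ (i, l) * Y $$ (l, k) - Y $$ (i, l) * X $$ (l, k))"
  using assms by (auto simp: ad_def scalar_prod_def atLeast0LessThan sum_subtractf)

definition skew :: "nat \<Rightarrow> complex mat set" where
  "skew n = {X \<in> carrier_mat n n. mat_adjoint X = - X}"

lemma ad_her_her: "X \<in> her n \<Longrightarrow> Y \<in> her n \<Longrightarrow> ad X Y \<in> skew n"
  by (auto simp: her_def skew_def ad_def mat_adjoint_minus[of _ n n] mat_adjoint_mult[of _ n n _ n]
      intro!: eq_matI)

lemma ad_skew_her: 
  assumes "X \<in> skew n" "Y \<in> her n" shows "ad X Y \<in> her n"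
proof -
  have c: "X \<in> carrier_mat n n" "Y \<in> carrier_mat n n" "mat_adjoint X = - X" "mat_adjoint Y = Y"
    using assms by (auto simp: her_def skew_def)
  have "mat_adjoint (ad X Y) = Y * - X - - X * Y"
    using c by (simp add: ad_def mat_adjoint_minus[of _ n n] mat_adjoint_mult[of _ n n _ n])
  also have "\<dots> = ad X Y" using c unfolding ad_def by (intro eq_matI) auto
  finally show ?thesis using c by (simp add: her_def)
qed

text \<open>
  The laws of the ring of square matrices with the size \<open>n\<close> left to be instantiated, since the
  simplifier cannot guess the sizes in the carrier conditions.
\<close>

lemmas mat_distribs = 
  assoc_mult_mat[of _ n n _ n _ n] add_mult_distrib_mat[of _ n n _ _ n]
  mult_add_distrib_mat[of _ n n _ n] minus_mult_distrib_mat[of _ n n _ _ n]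
  mult_minus_distrib_mat[of _ n n _ n] for n

lemma mat_cancel:
  fixes A B C :: "complex mat"
  assumes "A \<in> carrier_mat n n" "B \<in> carrier_mat n n" "C \<in> carrier_mat n n"
  shows "C - B + (A - C) = A - B" "A - 0\<^sub>m n n - (0\<^sub>m n n - B) = B + A"
  using assms by (auto intro!: eq_matI)

text \<open>
  Multiplying \<open>V = P V + V P\<close> by \<open>P\<close> gives \<open>P V P = 0\<close>: relative to the range and kernel of \<open>P\<close>,
  the matrix \<open>V\<close> has only off-diagonal blocks. The double commutator with \<open>P\<close> kills the diagonal
  blocks and fixes the off-diagonal ones; for Hermitian \<open>P\<close> it is the
  orthogonal projection onto the tangent space.
\<close>

lemma ad_ad_off_diagonal:
  assumes P: "P \<in> carrier_mat n n" "P * P = P" and V: "V \<in> carrier_mat n n" "V = P * V + V * P"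
  shows "ad (ad V P) P = V"
proof -
  have PP: "P * (P * X) = P * X" if "X \<in> carrier_mat n n" for X
    using that P assoc_mult_mat[of P n n P n X n] by simp
  let ?W = "P * (V * P)"
  have W: "?W \<in> carrier_mat n n" using P V(1) by simp
  have "P * V = P * (P * V + V * P)" using V(2) by (rule arg_cong)
  also have "\<dots> = P * V + ?W" using P V(1) PP by (simp add: mat_distribs[where n=n])
  finally have e: "P * V = P * V + ?W" .
  have W0: "?W = 0\<^sub>m n n"
  proof (rule eq_matI)
    fix i k assume "i < dim_row (0\<^sub>m n n :: complex mat)" "k < dim_col (0\<^sub>m n n :: complex mat)"
    then have ik: "i < n" "k < n" by auto
    have "(P * V) $$ (i, k) = (P * V + ?W) $$ (i, k)" using e by (rule arg_cong)
    also have "\<dots> = (P * V) $$ (i, k) + ?W $$ (i, k)"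
      using ik W P V(1) by (subst index_add_mat) auto
    finally show "?W $$ (i, k) = 0\<^sub>m n n $$ (i, k)" using ik by simp
  qed (use W in auto)
  have c: "V * P \<in> carrier_mat n n" "P * V \<in> carrier_mat n n" using P V(1) by auto
  have "ad (ad V P) P = V * P - ?W - (?W - P * V)"
    using P V(1) PP by (simp add: ad_def mat_distribs[where n=n])
  also have "\<dots> = P * V + V * P" unfolding W0 using c by (intro mat_cancel)
  finally show "ad (ad V P) P = V" unfolding V(2)[symmetric] .
qed

lemma ad_off_diagonal:
  assumes P: "P \<in> carrier_mat n n" "P * P = P" and X: "X \<in> carrier_mat n n"
  shows "ad X P = P * ad X P + ad X P * P"
proof -
  have PP: "P * (P * Y) = P * Y" if "Y \<in> carrier_mat n n" for Y
    using that P assoc_mult_mat[of P n n P n Y n] by simp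
  have c: "X * P \<in> carrier_mat n n" "P * X \<in> carrier_mat n n" "P * (X * P) \<in> carrier_mat n n"
    using P X by auto
  have "P * ad X P + ad X P * P = P * (X * P) - P * X + (X * P - P * (X * P))"
    using P X PP by (simp add: ad_def mat_distribs[where n=n])
  also have "\<dots> = ad X P" unfolding ad_def using c by (intro mat_cancel)
  finally show ?thesis by simp
qed

lemma mtrace_ad_swap:
  assumes "X \<in> carrier_mat n n" "Y \<in> carrier_mat n n" "P \<in> carrier_mat n n"
  shows "mtrace (ad X P * Y) = - mtrace (X * ad Y P)"
proof -
  have "mtrace (ad X P * Y) = mtrace (X * (P * Y)) - mtrace (P * (X * Y))"
    using assms by (simp add: ad_def mat_distribs[where n=n] mtrace_minus[of _ n])
  also have "mtrace (P * (X * Y)) = mtrace (X * (Y * P))"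
    using assms mtrace_comm[of P n n "X * Y"] by (simp add: mat_distribs[where n=n])
  finally show ?thesis
    using assms by (simp add: ad_def mat_distribs[where n=n] mtrace_minus[of _ n])
qed

text \<open>
  Self-adjointness of \<open>E \<mapsto> ad (ad E P) P\<close> for the trace pairing.
\<close>

lemma mtrace_ad_ad:
  assumes "E \<in> carrier_mat n n" "V \<in> carrier_mat n n" "P \<in> carrier_mat n n"
  shows "mtrace (ad (ad E P) P * V) = mtrace (E * ad (ad V P) P)"
  using assms by (simp add: mtrace_ad_swap[of _ n])

lemma mtrace_ad_0:
  assumes "X \<in> carrier_mat n n" "Y \<in> carrier_mat n n"
  shows "mtrace (ad X Y) = 0"
  using assms mtrace_comm[of X n n Y] by (simp add: ad_def mtrace_minus[of _ n])

section \<open>The Euclidean space of Hermitian tuples\<close>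

lemma her_prodD:
  assumes "X \<in> her_prod ns" "j < length ns"
  shows "X ! j \<in> her (ns ! j)" "X ! j \<in> carrier_mat (ns ! j) (ns ! j)" "length X = length ns"
  using assms her_carrier by (auto simp: her_prod_def)

lemma her_prod_length: "X \<in> her_prod ns \<Longrightarrow> length X = length ns"
  by (simp add: her_prod_def)

lemma length_tadd_tscale [simp]:
  "length (tadd X Y) = min (length X) (length Y)" "length (tscale a X) = length X"
  by (auto simp: tadd_def tscale_def)

lemma nth_tadd [simp]: "j < length X \<Longrightarrow> j < length Y \<Longrightarrow> tadd X Y ! j = X ! j + Y ! j"
  by (simp add: tadd_def)

lemma nth_tscale [simp]: "j < length X \<Longrightarrow> tscale a X ! j = complex_of_real a \<cdot>\<^sub>m X ! j"
  by (simp add: tscale_def)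

lemma her_prod_tadd: "X \<in> her_prod ns \<Longrightarrow> Y \<in> her_prod ns \<Longrightarrow> tadd X Y \<in> her_prod ns"
  by (auto simp: her_prod_def intro: her_add)

lemma her_prod_tscale: "X \<in> her_prod ns \<Longrightarrow> tscale a X \<in> her_prod ns"
  by (auto simp: her_prod_def intro: her_smult)

lemma tinner_commute:
  assumes "X \<in> her_prod ns" "Y \<in> her_prod ns"
  shows "tinner X Y = tinner Y X"
  unfolding tinner_def her_prod_length[OF assms(1)] her_prod_length[OF assms(2)]
  using mtrace_comm[OF her_prodD(2)[OF assms(1)] her_prodD(2)[OF assms(2)]] by simp

lemma tinner_linear_left:
  assumes X: "X \<in> her_prod ns" and Y: "Y \<in> her_prod ns" and Z: "Z \<in> her_prod ns"
  shows "tinner (tadd (tscale a X) (tscale b Y)) Z = a * tinner X Z + b * tinner Y Z"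
proof -
  have "Re (mtrace ((complex_of_real a \<cdot>\<^sub>m X ! j + complex_of_real b \<cdot>\<^sub>m Y ! j) * Z ! j)) =
      a * Re (mtrace (X ! j * Z ! j)) + b * Re (mtrace (Y ! j * Z ! j))" if j: "j < length ns" for j
  proof -
    note c = her_prodD(2)[OF X j] her_prodD(2)[OF Y j] her_prodD(2)[OF Z j]
    show ?thesis
      using c by (simp add: add_mult_distrib_mat[of _ "ns ! j" "ns ! j"] mtrace_add[of _ "ns ! j"]
          mult_smult_assoc_mat[of _ "ns ! j" "ns ! j"] mtrace_smult[of _ "ns ! j"])
  qed
  then show ?thesis using assms unfolding tinner_def
    by (simp add: her_prod_length sum.distrib sum_distrib_left)
qed

lemma tinner_linear_right:
  assumes X: "X \<in> her_prod ns" and Y: "Y \<in> her_prod ns" and Z: "Z \<in> her_prod ns"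
  shows "tinner Z (tadd (tscale a X) (tscale b Y)) = a * tinner Z X + b * tinner Z Y"
  using tinner_linear_left[OF assms] assms
  by (simp add: tinner_commute[of Z ns] her_prod_tadd her_prod_tscale)

lemma tinner_self:
  assumes "X \<in> her_prod ns"
  shows "tinner X X = (\<Sum>j<length ns. \<Sum>i<ns ! j. \<Sum>k<ns ! j. (cmod ((X ! j) $$ (i, k)))\<^sup>2)"
  using assms unfolding tinner_def
  by (auto simp: her_prod_length trace_her_sq[OF her_prodD(1)[OF assms]] intro!: sum.cong)

lemma tinner_self_nonneg: "X \<in> her_prod ns \<Longrightarrow> 0 \<le> tinner X X"
  by (simp add: tinner_self sum_nonneg)

lemma entry_le_tinner_self:
  assumes "X \<in> her_prod ns" "j < length ns" "i < ns ! j" "k < ns ! j"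
  shows "(cmod ((X ! j) $$ (i, k)))\<^sup>2 \<le> tinner X X"
proof -
  have "(cmod ((X ! j) $$ (i, k)))\<^sup>2 \<le> (\<Sum>k<ns ! j. (cmod ((X ! j) $$ (i, k)))\<^sup>2)"
    using assms by (intro member_le_sum) auto
  also have "\<dots> \<le> (\<Sum>i<ns ! j. \<Sum>k<ns ! j. (cmod ((X ! j) $$ (i, k)))\<^sup>2)"
    using assms by (intro member_le_sum[where f = "\<lambda>i. \<Sum>k<ns ! j. (cmod ((X ! j) $$ (i, k)))\<^sup>2"])
      (auto intro: sum_nonneg)
  also have "\<dots> \<le> tinner X X"
    unfolding tinner_self[OF assms(1)] using assms
    by (intro member_le_sum[where f = "\<lambda>j. \<Sum>i<ns ! j. \<Sum>k<ns ! j. (cmod ((X ! j) $$ (i, k)))\<^sup>2"])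
      (auto intro!: sum_nonneg)
  finally show ?thesis .
qed

lemma tinner_self_eq_0:
  assumes X: "X \<in> her_prod ns" and "tinner X X = 0" and j: "j < length ns"
  shows "X ! j = 0\<^sub>m (ns ! j) (ns ! j)"
proof (rule eq_matI)
  fix i k assume "i < dim_row (0\<^sub>m (ns ! j) (ns ! j) :: complex mat)"
    "k < dim_col (0\<^sub>m (ns ! j) (ns ! j) :: complex mat)"
  then show "(X ! j) $$ (i, k) = 0\<^sub>m (ns ! j) (ns ! j) $$ (i, k)"
    using entry_le_tinner_self[OF X j, of i k] assms(2) by simp
qed (use her_prodD(2)[OF X j] in auto)

lemma tuple_eq_if_tinner_diff_0:
  assumes X: "X \<in> her_prod ns" and Y: "Y \<in> her_prod ns"
    and "tinner (tadd (tscale 1 X) (tscale (- 1) Y)) (tadd (tscale 1 X) (tscale (- 1) Y)) = 0"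
  shows "X = Y"
proof (rule nth_equalityI)
  show "length X = length Y" using X Y by (simp add: her_prod_length)
  fix j assume "j < length X"
  then have j: "j < length ns" using X by (simp add: her_prod_length)
  note c = her_prodD(2)[OF X j] her_prodD(2)[OF Y j]
  let ?D = "tadd (tscale 1 X) (tscale (- 1) Y)"
  have D: "?D \<in> her_prod ns" using X Y by (intro her_prod_tadd her_prod_tscale)
  have D0: "?D ! j = 0\<^sub>m (ns ! j) (ns ! j)" by (rule tinner_self_eq_0[OF D assms(3) j])
  show "X ! j = Y ! j"
  proof (rule eq_matI)
    fix i k assume "i < dim_row (Y ! j)" "k < dim_col (Y ! j)"
    then have ik: "i < ns ! j" "k < ns ! j" using c by auto
    have "(?D ! j) $$ (i, k) = 0" using D0 ik by simp
    then show "(X ! j) $$ (i, k) = (Y ! j) $$ (i, k)"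
      using ik c j X Y by (simp add: her_prod_length)
  qed (use c in auto)
qed

lemma tdist_nonneg: "X \<in> her_prod ns \<Longrightarrow> Y \<in> her_prod ns \<Longrightarrow> 0 \<le> tdist X Y"
  unfolding tdist_def Let_def
  by (meson her_prod_tadd her_prod_tscale real_sqrt_ge_zero tinner_self_nonneg)

lemma tadd_tscale_index:
  assumes "X \<in> her_prod ns" "Y \<in> her_prod ns" "j < length ns" "i < ns ! j" "k < ns ! j"
  shows "(tadd X (tscale a Y) ! j) $$ (i, k) = (X ! j) $$ (i, k) + complex_of_real a * (Y ! j) $$ (i, k)"
  using assms her_prodD(2)[OF assms(1,3)] her_prodD(2)[OF assms(2,3)] by (simp add: her_prod_length)

text \<open>
  Coordinates are Lipschitz, which is where continuity of polynomials starts.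
\<close>

lemma entry_le_tdist:
  assumes "X \<in> her_prod ns" "Y \<in> her_prod ns" "j < length ns" "i < ns ! j" "k < ns ! j"
  shows "cmod ((Y ! j) $$ (i, k) - (X ! j) $$ (i, k)) \<le> tdist X Y"
proof -
  let ?D = "tadd X (tscale (- 1) Y)"
  have D: "?D \<in> her_prod ns" using assms by (intro her_prod_tadd her_prod_tscale)
  have "cmod ((?D ! j) $$ (i, k)) \<le> sqrt (tinner ?D ?D)"
    using entry_le_tinner_self[OF D assms(3-5)] by (rule real_le_rsqrt)
  moreover have "(?D ! j) $$ (i, k) = (X ! j) $$ (i, k) - (Y ! j) $$ (i, k)"
    using tadd_tscale_index[OF assms, of "- 1"] by simp
  ultimately show ?thesis
    by (simp add: tdist_def Let_def norm_minus_commute)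
qed

section \<open>Polynomial functions on tuples\<close>

text \<open>
  The neighbourhood filter of \<open>X\<close> for \<^const>\<open>tdist\<close>. It turns continuity into a limit, so that
  sums and products of continuous functions follow from the rules for limits.
\<close>

definition tnhds :: "nat list \<Rightarrow> tuple \<Rightarrow> tuple filter" where
  "tnhds ns X = inf (filtercomap (tdist X) (nhds 0)) (principal (her_prod ns))"

lemma eventually_tnhds:
  assumes "X \<in> her_prod ns"
  shows "eventually Q (tnhds ns X) \<longleftrightarrow> (\<exists>d>0. \<forall>Y\<in>her_prod ns. tdist X Y < d \<longrightarrow> Q Y)"
proof
  assume "eventually Q (tnhds ns X)"
  then obtain R where R: "eventually R (nhds (0::real))" "\<And>Y. R (tdist X Y) \<Longrightarrow> Y \<in> her_prod ns \<longrightarrow> Q Y"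
    unfolding tnhds_def eventually_inf_principal eventually_filtercomap by auto
  then obtain d where d: "d > 0" "\<And>y. dist y 0 < d \<Longrightarrow> R y"
    unfolding eventually_nhds_metric by blast
  have "Q Y" if "Y \<in> her_prod ns" "tdist X Y < d" for Y
    using R(2) d(2)[of "tdist X Y"] that tdist_nonneg[OF assms that(1)] by auto
  with d(1) show "\<exists>d>0. \<forall>Y\<in>her_prod ns. tdist X Y < d \<longrightarrow> Q Y" by auto
next
  assume "\<exists>d>0. \<forall>Y\<in>her_prod ns. tdist X Y < d \<longrightarrow> Q Y"
  then obtain d where d: "d > 0" "\<forall>Y\<in>her_prod ns. tdist X Y < d \<longrightarrow> Q Y" by blast
  have "eventually (\<lambda>y. y < d) (nhds (0::real))" using d(1) by (rule eventually_nhds_in_open[of "{..<d}", simplified])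
  with d(2) show "eventually Q (tnhds ns X)"
    unfolding tnhds_def eventually_inf_principal eventually_filtercomap
    by (intro exI[of _ "\<lambda>y. y < d"]) auto
qed

text \<open>
  Polynomials in the matrix entries, up to equality on \<^term>\<open>her_prod ns\<close>. Closure under partial
  derivatives makes their real parts smooth, and all functions and components of vector fields below
  are such real parts. The closure rule \<open>cong\<close> is what lets a formula that is polynomial only for tuples of
  the right sizes count as a polynomial.
\<close>

inductive polyfun :: "nat list \<Rightarrow> (tuple \<Rightarrow> complex) \<Rightarrow> bool" for ns where
  const: "polyfun ns (\<lambda>X. c)"
| entry: "j < length ns \<Longrightarrow> i < ns ! j \<Longrightarrow> k < ns ! j \<Longrightarrow> polyfun ns (\<lambda>X. (X ! j) $$ (i, k))"
| add: "polyfun ns f \<Longrightarrow> polyfun ns g \<Longrightarrow> polyfun ns (\<lambda>X. f X + g X)"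
| mult: "polyfun ns f \<Longrightarrow> polyfun ns g \<Longrightarrow> polyfun ns (\<lambda>X. f X * g X)"
| cong: "polyfun ns f \<Longrightarrow> (\<And>X. X \<in> her_prod ns \<Longrightarrow> f X = g X) \<Longrightarrow> polyfun ns g"

lemma polyfun_sum: "(\<And>i. i \<in> S \<Longrightarrow> polyfun ns (f i)) \<Longrightarrow> polyfun ns (\<lambda>X. \<Sum>i\<in>S. f i X)"
  by (induction S rule: infinite_finite_induct) (auto intro: polyfun.intros)

lemma polyfun_prod: "(\<And>i. i \<in> S \<Longrightarrow> polyfun ns (f i)) \<Longrightarrow> polyfun ns (\<lambda>X. \<Prod>i\<in>S. f i X)"
  by (induction S rule: infinite_finite_induct) (auto intro: polyfun.intros)

lemma polyfun_diff: 
  assumes "polyfun ns f" "polyfun ns g" shows "polyfun ns (\<lambda>X. f X - g X)"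
  by (rule polyfun.cong[OF polyfun.add[OF assms(1) polyfun.mult[OF polyfun.const[of _ "-1"] assms(2)]]]) simp

lemma polyfun_tendsto:
  assumes "polyfun ns f" "X \<in> her_prod ns"
  shows "(f \<longlongrightarrow> f X) (tnhds ns X)"
  using assms
proof (induction rule: polyfun.induct)
  case (entry j i k)
  show ?case
  proof (rule tendstoI)
    fix e :: real assume "e > 0"
    then show "\<forall>\<^sub>F Y in tnhds ns X. dist ((Y ! j) $$ (i, k)) ((X ! j) $$ (i, k)) < e"
      unfolding eventually_tnhds[OF entry(4)]
      using entry_le_tdist[OF entry(4) _ entry(1-3)]
      by (intro exI[of _ e]) (force simp: dist_norm)
  qed
next
  case (cong f g)
  have "\<forall>\<^sub>F Y in tnhds ns X. f Y = g Y"
    unfolding eventually_tnhds[OF cong(4)] using cong(2) by (intro exI[of _ 1]) auto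
  then show ?case using cong by (metis (mono_tags, lifting) tendsto_cong)
qed (auto intro: tendsto_intros)

lemma polyfun_tcontinuous_on:
  assumes "polyfun ns f" "U \<subseteq> her_prod ns"
  shows "tcontinuous_on U (\<lambda>X. Re (f X))"
  unfolding tcontinuous_on_def
proof (intro ballI allI impI)
  fix X and e :: real assume X: "X \<in> U" and e: "e > 0"
  have XH: "X \<in> her_prod ns" using X assms by blast
  have "((\<lambda>Y. Re (f Y)) \<longlongrightarrow> Re (f X)) (tnhds ns X)"
    by (intro tendsto_Re polyfun_tendsto[OF assms(1) XH])
  then have "\<forall>\<^sub>F Y in tnhds ns X. dist (Re (f Y)) (Re (f X)) < e" using e by (rule tendstoD)
  then show "\<exists>d>0. \<forall>Y\<in>U. tdist X Y < d \<longrightarrow> \<bar>Re (f Y) - Re (f X)\<bar> < e"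
    unfolding eventually_tnhds[OF XH] using assms(2) by (auto simp: dist_real_def)
qed

text \<open>
  For fixed \<open>V\<close> the derivative \<open>D X V\<close> is again a polynomial, so differentiation can be iterated.
  The same \<open>D\<close> serves for all curves, so the derivative depends on the point and the velocity only.
\<close>

lemma polyfun_derivative:
  assumes "polyfun ns f"
  shows "\<exists>D. (\<forall>V\<in>her_prod ns. polyfun ns (\<lambda>X. D X V)) \<and>
    (\<forall>c t \<xi>. (\<forall>s. c s \<in> her_prod ns) \<longrightarrow> curve_deriv ns c t \<xi> \<longrightarrow>
      ((\<lambda>s. f (c s)) has_vector_derivative D (c t) \<xi>) (at t))"
  using assms
proof (induction rule: polyfun.induct)
  case (const c)
  show ?case by (rule exI[of _ "\<lambda>X V. 0"]) (auto intro: polyfun.intros)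
next
  case (entry j i k)
  then show ?case
    by (intro exI[of _ "\<lambda>X V. (V ! j) $$ (i, k)"]) (auto intro: polyfun.intros simp: curve_deriv_def)
next
  case (add f g)
  obtain Df where Df: "\<forall>V\<in>her_prod ns. polyfun ns (\<lambda>X. Df X V)"
    "\<And>c t \<xi>. (\<forall>s. c s \<in> her_prod ns) \<Longrightarrow> curve_deriv ns c t \<xi> \<Longrightarrow>
      ((\<lambda>s. f (c s)) has_vector_derivative Df (c t) \<xi>) (at t)" using add.IH(1) by blast
  obtain Dg where Dg: "\<forall>V\<in>her_prod ns. polyfun ns (\<lambda>X. Dg X V)"
    "\<And>c t \<xi>. (\<forall>s. c s \<in> her_prod ns) \<Longrightarrow> curve_deriv ns c t \<xi> \<Longrightarrow>
      ((\<lambda>s. g (c s)) has_vector_derivative Dg (c t) \<xi>) (at t)" using add.IH(2) by blast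
  show ?case
    using Df Dg
    by (intro exI[of _ "\<lambda>X V. Df X V + Dg X V"]) (auto intro: polyfun.add has_vector_derivative_add)
next
  case (mult f g)
  obtain Df where Df: "\<forall>V\<in>her_prod ns. polyfun ns (\<lambda>X. Df X V)"
    "\<And>c t \<xi>. (\<forall>s. c s \<in> her_prod ns) \<Longrightarrow> curve_deriv ns c t \<xi> \<Longrightarrow>
      ((\<lambda>s. f (c s)) has_vector_derivative Df (c t) \<xi>) (at t)" using mult.IH(1) by blast
  obtain Dg where Dg: "\<forall>V\<in>her_prod ns. polyfun ns (\<lambda>X. Dg X V)"
    "\<And>c t \<xi>. (\<forall>s. c s \<in> her_prod ns) \<Longrightarrow> curve_deriv ns c t \<xi> \<Longrightarrow>
      ((\<lambda>s. g (c s)) has_vector_derivative Dg (c t) \<xi>) (at t)" using mult.IH(2) by blast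
  show ?case
    using Df Dg mult.hyps
    by (intro exI[of _ "\<lambda>X V. f X * Dg X V + Df X V * g X"])
      (auto intro!: polyfun.add polyfun.mult has_vector_derivative_mult)
next
  case (cong f g)
  obtain Df where Df: "\<forall>V\<in>her_prod ns. polyfun ns (\<lambda>X. Df X V)"
    "\<And>c t \<xi>. (\<forall>s. c s \<in> her_prod ns) \<Longrightarrow> curve_deriv ns c t \<xi> \<Longrightarrow>
      ((\<lambda>s. f (c s)) has_vector_derivative Df (c t) \<xi>) (at t)" using cong.IH by blast
  have "((\<lambda>s. g (c s)) has_vector_derivative Df (c t) \<xi>) (at t)"
    if "\<forall>s. c s \<in> her_prod ns" "curve_deriv ns c t \<xi>" for c t \<xi>
  proof -
    have "(\<lambda>s. g (c s)) = (\<lambda>s. f (c s))" using cong.hyps(2) that(1) by auto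
    then show ?thesis using Df(2)[OF that] by simp
  qed
  with Df(1) show ?case by (intro exI[of _ Df]) auto
qed

lemma has_real_derivative_Re:
  assumes "(f has_vector_derivative d) (at t)"
  shows "((\<lambda>s. Re (f s)) has_real_derivative Re d) (at t)"
  unfolding has_real_derivative_iff_has_vector_derivative
  by (rule bounded_linear.has_vector_derivative[OF bounded_linear_Re assms])

lemma curve_deriv_line:
  assumes "X \<in> her_prod ns" "V \<in> her_prod ns"
  shows "curve_deriv ns (\<lambda>t. tadd X (tscale t V)) t V"
  unfolding curve_deriv_def using assms
  by (auto simp: tadd_tscale_index has_vector_derivative_def intro!: derivative_eq_intros)
    (auto simp: scaleR_conv_of_real)

text \<open>
  Directional derivatives are derivatives along straight lines, which stay in the vector space.
\<close>

lemma polyfun_Ck_on: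
  assumes "polyfun ns f" "U \<subseteq> her_prod ns"
  shows "Ck_on ns k U (\<lambda>X. Re (f X))"
  using assms
proof (induction k arbitrary: f)
  case 0
  then show ?case by (simp add: polyfun_tcontinuous_on)
next
  case (Suc k)
  obtain D where D: "\<And>V. V \<in> her_prod ns \<Longrightarrow> polyfun ns (\<lambda>X. D X V)"
    "\<And>c t \<xi>. (\<forall>s. c s \<in> her_prod ns) \<Longrightarrow> curve_deriv ns c t \<xi> \<Longrightarrow>
      ((\<lambda>s. f (c s)) has_vector_derivative D (c t) \<xi>) (at t)"
    using polyfun_derivative[OF Suc.prems(1)] by blast
  have "((\<lambda>t. Re (f (tadd X (tscale t V)))) has_real_derivative Re (D X V)) (at 0)"
    if V: "V \<in> her_prod ns" and X: "X \<in> U" for V X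
  proof -
    have XH: "X \<in> her_prod ns" using X Suc.prems by blast
    have 0: "tadd X (tscale 0 V) = X"
    proof (intro nth_equalityI)
      fix j assume "j < length (tadd X (tscale 0 V))"
      then have j: "j < length ns" using XH by (simp add: her_prod_length)
      show "tadd X (tscale 0 V) ! j = X ! j"
        using j XH V her_prodD(2)[OF XH j] her_prodD(2)[OF V j]
        by (intro eq_matI) (auto simp: her_prod_length)
    qed (use XH V in \<open>simp add: her_prod_length\<close>)
    have "((\<lambda>s. f (tadd X (tscale s V))) has_vector_derivative D (tadd X (tscale 0 V)) V) (at 0)"
      by (intro D(2) allI her_prod_tadd her_prod_tscale XH V curve_deriv_line)
    then show ?thesis unfolding 0 by (rule has_real_derivative_Re)
  qed
  moreover have "Ck_on ns k U (\<lambda>X. Re (D X V))" if "V \<in> her_prod ns" for V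
    by (rule Suc.IH[OF D(1)[OF that] Suc.prems(2)])
  \<comment> \<open>The variable \<open>f'\<close> keeps \<open>Re (f _)\<close> folded when the existential is matched.\<close>
  ultimately have "\<exists>g. (\<forall>X\<in>U. ((\<lambda>t. f' (tadd X (tscale t V))) has_real_derivative g X) (at 0)) \<and>
      Ck_on ns k U g" if "V \<in> her_prod ns" "f' = (\<lambda>X. Re (f X))" for V f'
    using that by (intro exI[of _ "\<lambda>X. Re (D X V)"]) auto
  then show ?case
    using polyfun_tcontinuous_on[OF Suc.prems] by auto
qed

section \<open>Smooth functions and derivatives on submanifolds\<close>

lemma smooth_fun_polyfun:
  assumes "polyfun ns f" "M \<subseteq> her_prod ns" "\<And>q. q \<in> M \<Longrightarrow> h q = Re (f q)"
  shows "smooth_fun ns M h"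
  unfolding smooth_fun_def
proof
  fix p assume "p \<in> M"
  have "smooth_on ns (tball ns p 1) (\<lambda>X. Re (f X))"
    unfolding smooth_on_def using assms(1) by (auto intro!: polyfun_Ck_on simp: tball_def)
  then show "\<exists>e>0. \<exists>g. smooth_on ns (tball ns p e) g \<and> (\<forall>q\<in>M \<inter> tball ns p e. g q = h q)"
    using assms(3) by (intro exI[of _ 1] conjI exI[of _ "\<lambda>X. Re (f X)"]) auto
qed

lemma tangent_deriv_eqI:
  assumes "\<xi> \<in> tangent_space ns M p"
    and "\<And>c. curve_through ns M p \<xi> c \<Longrightarrow> ((\<lambda>t. f (c t)) has_real_derivative d) (at 0)"
  shows "tangent_deriv ns M f p \<xi> = d"
  unfolding tangent_deriv_def
proof (rule the_equality)
  show "\<forall>c. curve_through ns M p \<xi> c \<longrightarrow> ((\<lambda>t. f (c t)) has_real_derivative d) (at 0)"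
    using assms(2) by blast
  fix d' assume *: "\<forall>c. curve_through ns M p \<xi> c \<longrightarrow> ((\<lambda>t. f (c t)) has_real_derivative d') (at 0)"
  obtain c where "curve_through ns M p \<xi> c" using assms(1) unfolding tangent_space_def by blast
  then show "d' = d" using * assms(2) DERIV_unique by blast
qed

lemma curve_through_in: "curve_through ns M p \<xi> c \<Longrightarrow> c t \<in> M"
  by (auto simp: curve_through_def smooth_curve_def)

lemma tangent_deriv_cong:
  assumes "\<And>q. q \<in> M \<Longrightarrow> f q = g q"
  shows "tangent_deriv ns M f p \<xi> = tangent_deriv ns M g p \<xi>"
proof -
  have "(\<lambda>t. f (c t)) = (\<lambda>t. g (c t))" if "curve_through ns M p \<xi> c" for c
    using assms curve_through_in[OF that] by auto
  then show ?thesis unfolding tangent_deriv_def by (metis (no_types, lifting))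
qed

text \<open>
  \<^const>\<open>tangent_deriv\<close> is a definite description; for restrictions of polynomials it denotes the
  derivative along each single curve.
\<close>

lemma tangent_deriv_polyfun:
  assumes f: "polyfun ns f" and M: "M \<subseteq> her_prod ns" and h: "\<And>q. q \<in> M \<Longrightarrow> h q = Re (f q)"
    and c: "curve_through ns M p \<xi> c"
  shows "((\<lambda>t. h (c t)) has_real_derivative tangent_deriv ns M h p \<xi>) (at 0)"
proof -
  obtain D where D: "\<And>c t \<xi>. (\<forall>s. c s \<in> her_prod ns) \<Longrightarrow> curve_deriv ns c t \<xi> \<Longrightarrow>
      ((\<lambda>s. f (c s)) has_vector_derivative D (c t) \<xi>) (at t)"
    using polyfun_derivative[OF f] by blast
  have *: "((\<lambda>t. h (c t)) has_real_derivative Re (D p \<xi>)) (at 0)" if c: "curve_through ns M p \<xi> c" for c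
  proof -
    have eq: "(\<lambda>t. h (c t)) = (\<lambda>t. Re (f (c t)))" using h curve_through_in[OF c] by auto
    have "((\<lambda>s. f (c s)) has_vector_derivative D (c 0) \<xi>) (at 0)"
      using c M by (intro D) (auto simp: curve_through_def smooth_curve_def)
    then show ?thesis unfolding eq using c has_real_derivative_Re by (auto simp: curve_through_def)
  qed
  have "tangent_deriv ns M h p \<xi> = Re (D p \<xi>)"
    using c by (intro tangent_deriv_eqI *) (auto simp: tangent_space_def)
  with *[OF c] show ?thesis by simp
qed

section \<open>Traces against Kronecker products\<close>

text \<open>
  Hermitian slots are too restrictive here: the matrix \<open>Ahat ns A X j\<close> is determined by inserting arbitrary
  square matrices into slot \<open>j\<close>.
\<close>

definition sq_prod :: "nat list \<Rightarrow> tuple set" where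
  "sq_prod ns = {X. length X = length ns \<and> (\<forall>j<length ns. X ! j \<in> carrier_mat (ns ! j) (ns ! j))}"

lemma her_prod_sq_prod: "X \<in> her_prod ns \<Longrightarrow> X \<in> sq_prod ns"
  by (auto simp: sq_prod_def her_prod_def her_carrier)

lemma sq_prod_update:
  "X \<in> sq_prod ns \<Longrightarrow> j < length ns \<Longrightarrow> Z \<in> carrier_mat (ns ! j) (ns ! j) \<Longrightarrow> X[j := Z] \<in> sq_prod ns"
  by (auto simp: sq_prod_def nth_list_update)

text \<open>
  The mixed radix digits of \<open>i\<close> with respect to the bases \<open>ns\<close>, most significant digit first. They
  decompose a row index of a Kronecker product into row indices of its factors.
\<close>

fun digits :: "nat list \<Rightarrow> nat \<Rightarrow> nat list" where
  "digits [] i = []"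
| "digits (n # ns) i = (i div prod_list ns) # digits ns (i mod prod_list ns)"

lemma digits_less:
  assumes "i < prod_list ns" "j < length ns" shows "digits ns i ! j < ns ! j"
  using assms
proof (induction ns arbitrary: i j)
  case (Cons n ns)
  then have "prod_list ns > 0" by (cases "prod_list ns") auto
  then show ?case
    using Cons by (cases j) (auto simp: less_mult_imp_div_less)
qed simp

lemma kron_list_index:
  assumes "X \<in> sq_prod ns"
  shows "kron_list X \<in> carrier_mat (prod_list ns) (prod_list ns)"
    and "i < prod_list ns \<Longrightarrow> k < prod_list ns \<Longrightarrow>
      kron_list X $$ (i, k) = (\<Prod>j<length ns. (X ! j) $$ (digits ns i ! j, digits ns k ! j))"
  using assms
proof (induction ns arbitrary: X i k)
  case Nil
  { case 1 then show ?case by (simp add: sq_prod_def kron_list_def) }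
  { case 2 then show ?case by (simp add: sq_prod_def kron_list_def) }
next
  case (Cons n ns)
  have split: "\<exists>Y Ys. X = Y # Ys \<and> Y \<in> carrier_mat n n \<and> Ys \<in> sq_prod ns" if X: "X \<in> sq_prod (n # ns)" for X
  proof -
    obtain Y Ys where "X = Y # Ys" using X by (cases X) (auto simp: sq_prod_def)
    then show ?thesis using X by (fastforce simp: sq_prod_def)
  qed
  have k: "kron_list (Y # Ys) = kron Y (kron_list Ys)" for Y Ys by (simp add: kron_list_def)
  { case 1
    then obtain Y Ys where X: "X = Y # Ys" "Y \<in> carrier_mat n n" "Ys \<in> sq_prod ns" using split by blast
    show ?case unfolding X(1) k kron_def using X Cons.IH(1)[OF X(3)] by simp }
  { case 2
    then obtain Y Ys where X: "X = Y # Ys" "Y \<in> carrier_mat n n" "Ys \<in> sq_prod ns" using split by blast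
    have "prod_list ns > 0" using 2(1) by (cases "prod_list ns") auto
    then show ?case unfolding X(1) k kron_def
      using X Cons.IH(1)[OF X(3)] Cons.IH(2)[OF _ _ X(3)] 2
      by (simp add: prod.lessThan_Suc_shift del: prod.lessThan_Suc) }
qed

definition kron_trace :: "complex mat \<Rightarrow> tuple \<Rightarrow> complex" where
  "kron_trace A X = mtrace (A * kron_list X)"

text \<open>
  An explicit polynomial that is linear in each slot. Differentiability, the product rule and the
  representation of a slot by a matrix are all read off from it.
\<close>

lemma kron_trace_eq:
  assumes "A \<in> carrier_mat (prod_list ns) (prod_list ns)" "X \<in> sq_prod ns"
  shows "kron_trace A X = (\<Sum>i<prod_list ns. \<Sum>k<prod_list ns. A $$ (i, k) *
     (\<Prod>j<length ns. (X ! j) $$ (digits ns k ! j, digits ns i ! j)))"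
  unfolding kron_trace_def mtrace_mult[OF assms(1) kron_list_index(1)[OF assms(2)]]
  using kron_list_index(2)[OF assms(2)] by auto

lemma kron_trace_update_eq:
  assumes A: "A \<in> carrier_mat (prod_list ns) (prod_list ns)" and X: "X \<in> sq_prod ns"
    and j: "j < length ns" and Z: "Z \<in> carrier_mat (ns ! j) (ns ! j)"
  shows "kron_trace A (X[j := Z]) = (\<Sum>i<prod_list ns. \<Sum>k<prod_list ns. A $$ (i, k) *
     (Z $$ (digits ns k ! j, digits ns i ! j) *
       (\<Prod>l\<in>{..<length ns} - {j}. (X ! l) $$ (digits ns k ! l, digits ns i ! l))))"
  unfolding kron_trace_eq[OF A sq_prod_update[OF X j Z]]
  using X j by (auto simp: prod.remove[of "{..<length ns}" j] sq_prod_def intro!: sum.cong prod.cong)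

text \<open>
  Grouping the terms of \<open>kron_trace_update_eq\<close> by the entry of \<open>Z\<close> that they contain shows that the
  functional is a trace pairing.
\<close>

lemma kron_trace_slot_functional:
  assumes A: "A \<in> carrier_mat (prod_list ns) (prod_list ns)" and X: "X \<in> sq_prod ns"
    and j: "j < length ns"
  shows "\<exists>B\<in>carrier_mat (ns ! j) (ns ! j). \<forall>Z\<in>carrier_mat (ns ! j) (ns ! j).
      kron_trace A (X[j := Z]) = mtrace (B * Z)"
proof -
  let ?N = "{..<prod_list ns}" and ?n = "{..<ns ! j}"
  define w where "w i k = A $$ (i, k) *
    (\<Prod>l\<in>{..<length ns} - {j}. (X ! l) $$ (digits ns k ! l, digits ns i ! l))" for i k
  define B where "B = mat (ns ! j) (ns ! j) (\<lambda>(b, a). \<Sum>i\<in>?N. \<Sum>k\<in>?N.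
     if digits ns k ! j = a then (if digits ns i ! j = b then w i k else 0) else 0)"
  have B: "B \<in> carrier_mat (ns ! j) (ns ! j)" by (simp add: B_def)
  have "kron_trace A (X[j := Z]) = mtrace (B * Z)" if Z: "Z \<in> carrier_mat (ns ! j) (ns ! j)" for Z
  proof -
    have "mtrace (B * Z) = (\<Sum>b\<in>?n. \<Sum>a\<in>?n. \<Sum>i\<in>?N. \<Sum>k\<in>?N.
      (if digits ns k ! j = a then (if digits ns i ! j = b then w i k * Z $$ (a, b) else 0) else 0))"
      unfolding mtrace_mult[OF B Z]
      by (intro sum.cong refl) (auto simp: B_def sum_distrib_right intro!: sum.cong)
    also have "\<dots> = (\<Sum>b\<in>?n. \<Sum>i\<in>?N. \<Sum>a\<in>?n. \<Sum>k\<in>?N.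
      (if digits ns k ! j = a then (if digits ns i ! j = b then w i k * Z $$ (a, b) else 0) else 0))"
      by (intro sum.cong refl sum.swap)
    also have "\<dots> = (\<Sum>i\<in>?N. \<Sum>b\<in>?n. \<Sum>a\<in>?n. \<Sum>k\<in>?N.
      (if digits ns k ! j = a then (if digits ns i ! j = b then w i k * Z $$ (a, b) else 0) else 0))"
      by (rule sum.swap)
    also have "\<dots> = (\<Sum>i\<in>?N. \<Sum>b\<in>?n. \<Sum>k\<in>?N. \<Sum>a\<in>?n.
      (if digits ns k ! j = a then (if digits ns i ! j = b then w i k * Z $$ (a, b) else 0) else 0))"
      by (intro sum.cong refl sum.swap)
    also have "\<dots> = (\<Sum>i\<in>?N. \<Sum>k\<in>?N. \<Sum>b\<in>?n. \<Sum>a\<in>?n.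
      (if digits ns k ! j = a then (if digits ns i ! j = b then w i k * Z $$ (a, b) else 0) else 0))"
      by (intro sum.cong refl sum.swap)
    also have "\<dots> = (\<Sum>i\<in>?N. \<Sum>k\<in>?N. w i k * Z $$ (digits ns k ! j, digits ns i ! j))"
      using digits_less[OF _ j] by (intro sum.cong refl) simp
    also have "\<dots> = kron_trace A (X[j := Z])"
      unfolding kron_trace_update_eq[OF A X j Z] w_def by (intro sum.cong refl) (simp add: mult_ac)
    finally show ?thesis by simp
  qed
  with B show ?thesis by blast
qed

lemma mtrace_mult_cancel:
  assumes B: "B \<in> carrier_mat n n" and C: "C \<in> carrier_mat n n"
    and eq: "\<And>Z. Z \<in> carrier_mat n n \<Longrightarrow> mtrace (B * Z) = mtrace (C * Z)"
  shows "B = C"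
proof (rule eq_matI)
  fix a b assume "a < dim_row C" "b < dim_col C"
  then have ab: "a < n" "b < n" using C by auto
  \<comment> \<open>The matrix unit at position \<open>(b, a)\<close>.\<close>
  define Z :: "complex mat" where "Z = mat n n (\<lambda>(k, i). if k = b then (if i = a then 1 else 0) else 0)"
  have Z: "Z \<in> carrier_mat n n" by (simp add: Z_def)
  have "mtrace (Y * Z) = Y $$ (a, b)" if "Y \<in> carrier_mat n n" for Y
  proof -
    have "mtrace (Y * Z) = (\<Sum>i<n. \<Sum>k<n. if k = b then (if i = a then Y $$ (i, k) else 0) else 0)"
      unfolding mtrace_mult[OF that Z] by (intro sum.cong refl) (auto simp: Z_def)
    then show ?thesis using ab by simp
  qed
  then show "B $$ (a, b) = C $$ (a, b)" using eq[OF Z] B C by simp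
qed (use B C in auto)

text \<open>
  The description defining \<^const>\<open>Ahat\<close> is proper: \<open>kron_trace_slot_functional\<close> gives existence
  and \<open>mtrace_mult_cancel\<close> uniqueness.
\<close>

lemma Ahat:
  assumes A: "A \<in> carrier_mat (prod_list ns) (prod_list ns)" and X: "X \<in> sq_prod ns"
    and j: "j < length ns"
  shows "Ahat ns A X j \<in> carrier_mat (ns ! j) (ns ! j)"
    and "Z \<in> carrier_mat (ns ! j) (ns ! j) \<Longrightarrow> kron_trace A (X[j := Z]) = mtrace (Ahat ns A X j * Z)"
proof -
  let ?Q = "\<lambda>B. B \<in> carrier_mat (ns ! j) (ns ! j) \<and>
     (\<forall>Z\<in>carrier_mat (ns ! j) (ns ! j). mtrace (A * kron_list (X[j := Z])) = mtrace (B * Z))"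
  have "\<exists>!B. ?Q B"
  proof (rule ex_ex1I)
    show "\<exists>B. ?Q B" using kron_trace_slot_functional[OF assms] unfolding kron_trace_def by blast
    show "B = C" if "?Q B" "?Q C" for B C
      using that by (intro mtrace_mult_cancel[of B "ns ! j"]) auto
  qed
  then have "?Q (Ahat ns A X j)" unfolding Ahat_def by (rule theI')
  then show "Ahat ns A X j \<in> carrier_mat (ns ! j) (ns ! j)"
    "Z \<in> carrier_mat (ns ! j) (ns ! j) \<Longrightarrow> kron_trace A (X[j := Z]) = mtrace (Ahat ns A X j * Z)"
    unfolding kron_trace_def by blast+
qed

lemma has_vector_derivative_prod:
  fixes f :: "'i \<Rightarrow> real \<Rightarrow> complex"
  assumes "finite S" "\<And>i. i \<in> S \<Longrightarrow> (f i has_vector_derivative f' i) (at t)"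
  shows "((\<lambda>s. \<Prod>i\<in>S. f i s) has_vector_derivative (\<Sum>i\<in>S. f' i * (\<Prod>l\<in>S - {i}. f l t))) (at t)"
  unfolding has_vector_derivative_def
  by (rule has_derivative_eq_rhs[OF has_derivative_prod[where f' = "\<lambda>i h. h *\<^sub>R f' i"]])
    (use assms(2) in \<open>auto simp: has_vector_derivative_def scaleR_sum_right\<close>)

lemma kron_trace_derivative:
  assumes A: "A \<in> carrier_mat (prod_list ns) (prod_list ns)"
    and c: "\<And>s. c s \<in> her_prod ns" and d: "curve_deriv ns c t \<xi>"
  shows "((\<lambda>s. kron_trace A (c s)) has_vector_derivative
      (\<Sum>j<length ns. kron_trace A ((c t)[j := \<xi> ! j]))) (at t)"
proof -
  let ?N = "prod_list ns"
  have cs: "c s \<in> sq_prod ns" for s using c her_prod_sq_prod by blast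
  have \<xi>: "\<xi> \<in> her_prod ns" using d by (simp add: curve_deriv_def)
  let ?e = "\<lambda>X i k j. (X ! j) $$ (digits ns k ! j, digits ns i ! j)"
  have "((\<lambda>s. \<Prod>j<length ns. ?e (c s) i k j) has_vector_derivative
      (\<Sum>j<length ns. ?e \<xi> i k j * (\<Prod>l\<in>{..<length ns} - {j}. ?e (c t) i k l))) (at t)"
    if "i < ?N" "k < ?N" for i k
    using d that digits_less by (intro has_vector_derivative_prod) (auto simp: curve_deriv_def)
  then have "((\<lambda>s. \<Sum>i<?N. \<Sum>k<?N. A $$ (i, k) * (\<Prod>j<length ns. ?e (c s) i k j)) has_vector_derivative
      (\<Sum>i<?N. \<Sum>k<?N. A $$ (i, k) * (\<Sum>j<length ns. ?e \<xi> i k j * (\<Prod>l\<in>{..<length ns} - {j}. ?e (c t) i k l)))) (at t)"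
    by (intro has_vector_derivative_sum has_vector_derivative_mult_right) auto
  also have "(\<Sum>i<?N. \<Sum>k<?N. A $$ (i, k) * (\<Sum>j<length ns. ?e \<xi> i k j * (\<Prod>l\<in>{..<length ns} - {j}. ?e (c t) i k l)))
     = (\<Sum>i<?N. \<Sum>k<?N. \<Sum>j<length ns. A $$ (i, k) * (?e \<xi> i k j * (\<Prod>l\<in>{..<length ns} - {j}. ?e (c t) i k l)))"
    by (simp add: sum_distrib_left)
  also have "\<dots> = (\<Sum>i<?N. \<Sum>j<length ns. \<Sum>k<?N. A $$ (i, k) * (?e \<xi> i k j * (\<Prod>l\<in>{..<length ns} - {j}. ?e (c t) i k l)))"
    by (intro sum.cong refl sum.swap)
  also have "\<dots> = (\<Sum>j<length ns. \<Sum>i<?N. \<Sum>k<?N. A $$ (i, k) * (?e \<xi> i k j * (\<Prod>l\<in>{..<length ns} - {j}. ?e (c t) i k l)))"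
    by (rule sum.swap)
  also have "\<dots> = (\<Sum>j<length ns. kron_trace A ((c t)[j := \<xi> ! j]))"
    by (intro sum.cong refl kron_trace_update_eq[OF A cs, symmetric] her_prodD(2)[OF \<xi>]) auto
  finally show ?thesis unfolding kron_trace_eq[OF A cs] .
qed

lemma polyfun_kron_trace:
  assumes A: "A \<in> carrier_mat (prod_list ns) (prod_list ns)"
    and F: "\<And>X. X \<in> her_prod ns \<Longrightarrow> F X \<in> sq_prod ns"
    and p: "\<And>j i k. j < length ns \<Longrightarrow> i < ns ! j \<Longrightarrow> k < ns ! j \<Longrightarrow> polyfun ns (\<lambda>X. (F X ! j) $$ (i, k))"
  shows "polyfun ns (\<lambda>X. kron_trace A (F X))"
proof (rule polyfun.cong)
  show "polyfun ns (\<lambda>X. \<Sum>i<prod_list ns. \<Sum>k<prod_list ns. A $$ (i, k) *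
     (\<Prod>j<length ns. (F X ! j) $$ (digits ns k ! j, digits ns i ! j)))"
    using digits_less by (intro polyfun_sum polyfun.mult polyfun.const polyfun_prod p) auto
qed (simp add: kron_trace_eq[OF A F])

lemma rayleigh_eq: "rayleigh A X = Re (kron_trace A X)"
  by (simp add: rayleigh_def kron_trace_def)

section \<open>Orbits of one-parameter groups of conjugations\<close>

definition mat_deriv :: "nat \<Rightarrow> (real \<Rightarrow> complex mat) \<Rightarrow> complex mat \<Rightarrow> real \<Rightarrow> bool" where
  "mat_deriv n F F' t \<longleftrightarrow> (\<forall>s. F s \<in> carrier_mat n n) \<and> F' \<in> carrier_mat n n \<and>
    (\<forall>i<n. \<forall>k<n. ((\<lambda>s. F s $$ (i, k)) has_vector_derivative F' $$ (i, k)) (at t))"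

lemma mat_deriv_mult:
  assumes "mat_deriv n F F' t" "mat_deriv n G G' t"
  shows "mat_deriv n (\<lambda>s. F s * G s) (F t * G' + F' * G t) t"
proof -
  have c: "F s \<in> carrier_mat n n" "F' \<in> carrier_mat n n" "G s \<in> carrier_mat n n" "G' \<in> carrier_mat n n" for s
    using assms by (auto simp: mat_deriv_def)
  have "((\<lambda>s. \<Sum>l<n. F s $$ (i, l) * G s $$ (l, k)) has_vector_derivative
      (\<Sum>l<n. F t $$ (i, l) * G' $$ (l, k) + F' $$ (i, l) * G t $$ (l, k))) (at t)" if "i < n" "k < n" for i k
    using assms that by (intro has_vector_derivative_sum has_vector_derivative_mult) (auto simp: mat_deriv_def)
  moreover have "(F s * G s) $$ (i, k) = (\<Sum>l<n. F s $$ (i, l) * G s $$ (l, k))" if "i < n" "k < n" for i k s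
    using c(1)[of s] c(3)[of s] that by (simp add: scalar_prod_def atLeast0LessThan)
  moreover have "(F t * G' + F' * G t) $$ (i, k) =
      (\<Sum>l<n. F t $$ (i, l) * G' $$ (l, k) + F' $$ (i, l) * G t $$ (l, k))" if "i < n" "k < n" for i k
    using c(1)[of t] c(3)[of t] c(2,4) that by (simp add: scalar_prod_def atLeast0LessThan sum.distrib)
  moreover have "F s * G s \<in> carrier_mat n n" for s using c by (auto intro: mult_carrier_mat)
  moreover have "F t * G' + F' * G t \<in> carrier_mat n n" using c by (auto intro: mult_carrier_mat)
  ultimately show ?thesis unfolding mat_deriv_def by simp
qed

lemma mat_deriv_minus:
  assumes "mat_deriv n F F' t" "mat_deriv n G G' t"
  shows "mat_deriv n (\<lambda>s. F s - G s) (F' - G') t"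
  unfolding mat_deriv_def
proof (intro conjI allI impI)
  have c: "F s \<in> carrier_mat n n" "F' \<in> carrier_mat n n" "G s \<in> carrier_mat n n" "G' \<in> carrier_mat n n" for s
    using assms by (auto simp: mat_deriv_def)
  show "F s - G s \<in> carrier_mat n n" for s using c by (auto intro: minus_carrier_mat)
  show "F' - G' \<in> carrier_mat n n" using c by (auto intro: minus_carrier_mat)
  fix i k assume ik: "i < n" "k < n"
  have 1: "(F s - G s) $$ (i, k) = F s $$ (i, k) - G s $$ (i, k)" for s
    using c(1)[of s] c(3)[of s] ik by simp
  have 2: "(F' - G') $$ (i, k) = F' $$ (i, k) - G' $$ (i, k)" using c ik by simp
  show "((\<lambda>s. (F s - G s) $$ (i, k)) has_vector_derivative (F' - G') $$ (i, k)) (at t)"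
    unfolding 1 2 using assms ik by (intro has_vector_derivative_diff) (auto simp: mat_deriv_def)
qed

lemma mat_deriv_mtrace:
  assumes "mat_deriv n F F' t"
  shows "((\<lambda>s. mtrace (F s)) has_vector_derivative mtrace F') (at t)"
proof -
  have 1: "mtrace (F s) = (\<Sum>i<n. F s $$ (i, i))" for s
    using assms by (auto simp: mat_deriv_def mtrace_def)
  have 2: "mtrace F' = (\<Sum>i<n. F' $$ (i, i))"
    using assms by (auto simp: mat_deriv_def mtrace_def)
  show ?thesis unfolding 1 2 using assms
    by (intro has_vector_derivative_sum) (auto simp: mat_deriv_def)
qed

lemma complex_zero_derivative_constant:
  fixes f :: "real \<Rightarrow> complex"
  assumes "\<And>t. (f has_vector_derivative 0) (at t)"
  shows "f s = f t"
proof (rule complex_eqI)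
  have "\<forall>t. ((\<lambda>s. Re (f s)) has_real_derivative 0) (at t)"
    using has_real_derivative_Re[OF assms] by simp
  then show "Re (f s) = Re (f t)" by (rule DERIV_isconst_all)
  have "((\<lambda>s. Im (f s)) has_real_derivative Im 0) (at t)" for t
    unfolding has_real_derivative_iff_has_vector_derivative
    by (rule bounded_linear.has_vector_derivative[OF bounded_linear_Im assms])
  then have "\<forall>t. ((\<lambda>s. Im (f s)) has_real_derivative 0) (at t)" by simp
  then show "Im (f s) = Im (f t)" by (rule DERIV_isconst_all)
qed

lemma has_vector_derivative_unique:
  assumes "(f has_vector_derivative a) (at t)" "(f has_vector_derivative b) (at t)"
  shows "a = b"
proof -
  have "(\<lambda>h. h *\<^sub>R a) = (\<lambda>h. h *\<^sub>R b)"
    using assms unfolding has_vector_derivative_def by (rule has_derivative_unique)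
  then have "1 *\<^sub>R a = 1 *\<^sub>R b" by metis
  then show ?thesis by simp
qed

lemma ad_power_carrier:
  "\<Omega> \<in> carrier_mat n n \<Longrightarrow> P \<in> carrier_mat n n \<Longrightarrow> (ad \<Omega> ^^ m) P \<in> carrier_mat n n"
  by (induction m) auto

text \<open>
  A commutator of \<open>n \<times> n\<close> matrices has \<open>2 n\<close> products in each entry, so iterating \<open>ad \<Omega>\<close> grows at
  most geometrically and the exponential series below converges.
\<close>

lemma ad_power_bound:
  assumes \<Omega>: "\<Omega> \<in> carrier_mat n n" and P: "P \<in> carrier_mat n n"
  shows "\<exists>C K. \<forall>m. \<forall>a<n. \<forall>b<n. cmod ((ad \<Omega> ^^ m) P $$ (a, b)) \<le> C * K ^ m"
proof -
  define L where "L X = (\<Sum>a<n. \<Sum>b<n. cmod (X $$ (a, b)))" for X :: "complex mat"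
  have le: "cmod (X $$ (a, b)) \<le> L X" if "a < n" "b < n" for X a b
  proof -
    have "cmod (X $$ (a, b)) \<le> (\<Sum>b<n. cmod (X $$ (a, b)))"
      using that by (intro member_le_sum) auto
    also have "\<dots> \<le> L X" unfolding L_def using that
      by (intro member_le_sum[where f = "\<lambda>a. \<Sum>b<n. cmod (X $$ (a, b))"]) (auto intro: sum_nonneg)
    finally show ?thesis .
  qed
  have L0: "L X \<ge> 0" for X unfolding L_def by (intro sum_nonneg) auto
  have "cmod ((ad \<Omega> ^^ m) P $$ (a, b)) \<le> L P * (2 * real n * L \<Omega>) ^ m" if "a < n" "b < n" for m a b
    using that
  proof (induction m arbitrary: a b)
    case 0
    then show ?case using le by simp
  next
    case (Suc m)
    let ?M = "(ad \<Omega> ^^ m) P" and ?c = "L P * (2 * real n * L \<Omega>) ^ m"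
    have M: "?M \<in> carrier_mat n n" by (rule ad_power_carrier[OF \<Omega> P])
    have c0: "?c \<ge> 0" using L0 by simp
    have "cmod (ad \<Omega> ?M $$ (a, b)) \<le>
        (\<Sum>l<n. cmod (\<Omega> $$ (a, l) * ?M $$ (l, b) - ?M $$ (a, l) * \<Omega> $$ (l, b)))"
      unfolding ad_index[OF \<Omega> M Suc.prems] by (rule norm_sum)
    also have "\<dots> \<le> (\<Sum>l<n. L \<Omega> * ?c + ?c * L \<Omega>)"
    proof (rule sum_mono)
      fix l assume "l \<in> {..<n}"
      then have l: "l < n" by simp
      have "cmod (\<Omega> $$ (a, l) * ?M $$ (l, b) - ?M $$ (a, l) * \<Omega> $$ (l, b)) \<le>
          cmod (\<Omega> $$ (a, l)) * cmod (?M $$ (l, b)) + cmod (?M $$ (a, l)) * cmod (\<Omega> $$ (l, b))"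
        by (metis norm_triangle_ineq4 norm_mult)
      also have "\<dots> \<le> L \<Omega> * ?c + ?c * L \<Omega>"
        using l Suc.prems le Suc.IH c0 L0 by (intro add_mono mult_mono) auto
      finally show "cmod (\<Omega> $$ (a, l) * ?M $$ (l, b) - ?M $$ (a, l) * \<Omega> $$ (l, b)) \<le> L \<Omega> * ?c + ?c * L \<Omega>" .
    qed
    also have "\<dots> = L P * (2 * real n * L \<Omega>) ^ Suc m" by simp
    finally show ?case by simp
  qed
  then show ?thesis by blast
qed

text \<open>
  \<open>flow \<Omega> P k t\<close> is the \<open>k\<close>-th derivative at \<open>t\<close> of \<open>exp (t (ad \<Omega>)) P = exp (t \<Omega>) P exp (- t \<Omega>)\<close>,
  entry by entry. With the series in powers of \<open>ad \<Omega>\<close> the differential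
  equation \<open>c' = ad \<Omega> c\<close> of \<open>c = flow \<Omega> P 0\<close> can be read off term by term.
\<close>

definition flow :: "complex mat \<Rightarrow> complex mat \<Rightarrow> nat \<Rightarrow> real \<Rightarrow> complex mat" where
  "flow \<Omega> P k t = mat (dim_row P) (dim_row P)
     (\<lambda>(a, b). \<Sum>m. (ad \<Omega> ^^ (m + k)) P $$ (a, b) / fact m * complex_of_real t ^ m)"

lemma flow_carrier [simp]: "P \<in> carrier_mat n n \<Longrightarrow> flow \<Omega> P k t \<in> carrier_mat n n"
  by (auto simp: flow_def)

lemma flow_summable:
  assumes \<Omega>: "\<Omega> \<in> carrier_mat n n" and P: "P \<in> carrier_mat n n" and "a < n" "b < n"
  shows "summable (\<lambda>m. (ad \<Omega> ^^ (m + k)) P $$ (a, b) / fact m * y ^ m)"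
proof -
  obtain C K where K: "\<And>m. cmod ((ad \<Omega> ^^ m) P $$ (a, b)) \<le> C * K ^ m"
    using ad_power_bound[OF \<Omega> P] assms(3,4) by blast
  show ?thesis
  proof (rule summable_comparison_test')
    show "summable (\<lambda>m. (C * K ^ k) * (inverse (fact m) * (K * cmod y) ^ m))"
      by (intro summable_mult summable_exp)
    fix m :: nat
    have "norm ((ad \<Omega> ^^ (m + k)) P $$ (a, b) / fact m * y ^ m) =
        cmod ((ad \<Omega> ^^ (m + k)) P $$ (a, b)) * (cmod y ^ m / fact m)"
      by (simp add: norm_mult norm_divide norm_power)
    also have "\<dots> \<le> (C * K ^ (m + k)) * (cmod y ^ m / fact m)"
      by (intro mult_right_mono K) simp
    also have "\<dots> = (C * K ^ k) * (inverse (fact m) * (K * cmod y) ^ m)"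
      by (simp add: power_add power_mult_distrib field_simps)
    finally show "norm ((ad \<Omega> ^^ (m + k)) P $$ (a, b) / fact m * y ^ m) \<le>
        (C * K ^ k) * (inverse (fact m) * (K * cmod y) ^ m)" .
  qed
qed

lemma flow_deriv:
  assumes \<Omega>: "\<Omega> \<in> carrier_mat n n" and P: "P \<in> carrier_mat n n"
  shows "mat_deriv n (flow \<Omega> P k) (flow \<Omega> P (Suc k) t) t"
  unfolding mat_deriv_def
proof (intro conjI allI impI flow_carrier P)
  fix a b assume ab: "a < n" "b < n"
  let ?c = "\<lambda>m. (ad \<Omega> ^^ (m + k)) P $$ (a, b) / fact m"
  \<comment> \<open>The factorials make formal differentiation a shift of the power of \<open>ad \<Omega>\<close>.\<close>
  have d: "diffs ?c = (\<lambda>m. (ad \<Omega> ^^ (m + Suc k)) P $$ (a, b) / fact m)"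
    by (simp add: diffs_def fun_eq_iff divide_simps del: of_nat_Suc)
  have "((\<lambda>x. \<Sum>m. ?c m * x ^ m) has_field_derivative (\<Sum>m. diffs ?c m * complex_of_real t ^ m)) (at (complex_of_real t))"
    by (intro termdiffs_strong_converges_everywhere flow_summable[OF \<Omega> P ab])
  then have "((\<lambda>x. \<Sum>m. ?c m * complex_of_real x ^ m) has_vector_derivative
      (\<Sum>m. diffs ?c m * complex_of_real t ^ m)) (at t)"
    by (rule has_vector_derivative_real_field)
  then show "((\<lambda>s. flow \<Omega> P k s $$ (a, b)) has_vector_derivative flow \<Omega> P (Suc k) t $$ (a, b)) (at t)"
    using ab P unfolding d by (simp add: flow_def)
qed

lemma flow_0: "P \<in> carrier_mat n n \<Longrightarrow> flow \<Omega> P 0 0 = P"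
  using powser_zero[of "\<lambda>m. (ad \<Omega> ^^ m) P $$ (i, j) / fact m" for i j]
  by (intro eq_matI) (auto simp: flow_def simp del: times_divide_eq_left)

lemma flow_Suc:
  assumes \<Omega>: "\<Omega> \<in> carrier_mat n n" and P: "P \<in> carrier_mat n n"
  shows "flow \<Omega> P (Suc k) t = ad \<Omega> (flow \<Omega> P k t)"
proof (rule eq_matI)
  have c: "flow \<Omega> P k t \<in> carrier_mat n n" for k using P by simp
  have C: "ad \<Omega> (flow \<Omega> P k t) \<in> carrier_mat n n" using c \<Omega> by simp
  show "dim_row (flow \<Omega> P (Suc k) t) = dim_row (ad \<Omega> (flow \<Omega> P k t))"
    "dim_col (flow \<Omega> P (Suc k) t) = dim_col (ad \<Omega> (flow \<Omega> P k t))" using c[of "Suc k"] C by auto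
  fix a b assume "a < dim_row (ad \<Omega> (flow \<Omega> P k t))" "b < dim_col (ad \<Omega> (flow \<Omega> P k t))"
  then have ab: "a < n" "b < n" using C by auto
  let ?M = "\<lambda>m. (ad \<Omega> ^^ (m + k)) P" and ?t = "complex_of_real t"
  have M: "?M m \<in> carrier_mat n n" for m by (rule ad_power_carrier[OF \<Omega> P])
  have s: "(\<lambda>m. ?M m $$ (i, l) / fact m * ?t ^ m) sums flow \<Omega> P k t $$ (i, l)" if "i < n" "l < n" for i l
    using summable_sums[OF flow_summable[OF \<Omega> P that, of k ?t]] P that by (simp add: flow_def)
  have "(\<lambda>m. \<Sum>l<n. \<Omega> $$ (a, l) * (?M m $$ (l, b) / fact m * ?t ^ m) - (?M m $$ (a, l) / fact m * ?t ^ m) * \<Omega> $$ (l, b))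
      sums (\<Sum>l<n. \<Omega> $$ (a, l) * flow \<Omega> P k t $$ (l, b) - flow \<Omega> P k t $$ (a, l) * \<Omega> $$ (l, b))"
    using ab by (intro sums_sum sums_diff sums_mult sums_mult2 s) auto
  also have "(\<lambda>m. \<Sum>l<n. \<Omega> $$ (a, l) * (?M m $$ (l, b) / fact m * ?t ^ m) - (?M m $$ (a, l) / fact m * ?t ^ m) * \<Omega> $$ (l, b))
      = (\<lambda>m. (ad \<Omega> ^^ (m + Suc k)) P $$ (a, b) / fact m * ?t ^ m)"
  proof
    fix m
    have "(ad \<Omega> ^^ (m + Suc k)) P $$ (a, b) / fact m * ?t ^ m =
      (\<Sum>l<n. (\<Omega> $$ (a, l) * ?M m $$ (l, b) - ?M m $$ (a, l) * \<Omega> $$ (l, b)) / fact m * ?t ^ m)"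
      by (simp add: ad_index[OF \<Omega> M ab] sum_divide_distrib sum_distrib_right)
    also have "\<dots> = (\<Sum>l<n. \<Omega> $$ (a, l) * (?M m $$ (l, b) / fact m * ?t ^ m) -
        (?M m $$ (a, l) / fact m * ?t ^ m) * \<Omega> $$ (l, b))"
      by (intro sum.cong refl) (simp add: algebra_simps diff_divide_distrib)
    finally show "(\<Sum>l<n. \<Omega> $$ (a, l) * (?M m $$ (l, b) / fact m * ?t ^ m) -
        (?M m $$ (a, l) / fact m * ?t ^ m) * \<Omega> $$ (l, b)) =
      (ad \<Omega> ^^ (m + Suc k)) P $$ (a, b) / fact m * ?t ^ m" by simp
  qed
  finally show "flow \<Omega> P (Suc k) t $$ (a, b) = ad \<Omega> (flow \<Omega> P k t) $$ (a, b)"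
    using ab P unfolding ad_index[OF \<Omega> c ab] by (simp add: flow_def sums_iff)
qed

lemma ad_power_her: "\<Omega> \<in> skew n \<Longrightarrow> P \<in> her n \<Longrightarrow> (ad \<Omega> ^^ m) P \<in> her n"
  by (induction m) (auto intro: ad_skew_her)

lemma flow_her:
  assumes \<Omega>: "\<Omega> \<in> skew n" and P: "P \<in> her n"
  shows "flow \<Omega> P k t \<in> her n"
  unfolding her_iff_entries
proof (intro conjI allI impI)
  have c: "\<Omega> \<in> carrier_mat n n" "P \<in> carrier_mat n n" using assms by (auto simp: skew_def her_carrier)
  show "flow \<Omega> P k t \<in> carrier_mat n n" using c by simp
  fix a b assume ab: "a < n" "b < n"
  let ?g = "\<lambda>a b m. (ad \<Omega> ^^ (m + k)) P $$ (a, b) / fact m * complex_of_real t ^ m"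
  have "?g b a sums flow \<Omega> P k t $$ (b, a)"
    using summable_sums[OF flow_summable[OF c ab(2,1), of k "complex_of_real t"]] c ab
    by (simp add: flow_def)
  then have "(\<lambda>m. cnj (?g b a m)) sums cnj (flow \<Omega> P k t $$ (b, a))"
    unfolding sums_cnj .
  moreover have "cnj (?g b a m) = ?g a b m" for m
  proof -
    have "(ad \<Omega> ^^ (m + k)) P $$ (a, b) = cnj ((ad \<Omega> ^^ (m + k)) P $$ (b, a))"
      using ad_power_her[OF assms] ab unfolding her_iff_entries by blast
    then show ?thesis by simp
  qed
  ultimately have "?g a b sums cnj (flow \<Omega> P k t $$ (b, a))" by (simp only:)
  moreover have "flow \<Omega> P k t $$ (a, b) = suminf (?g a b)" using c ab by (simp add: flow_def)
  ultimately show "flow \<Omega> P k t $$ (a, b) = cnj (flow \<Omega> P k t $$ (b, a))"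
    by (simp only: sums_iff)
qed

text \<open>
  \<open>ad \<Omega>\<close> is a derivation.
\<close>

lemma ad_mult:
  assumes "\<Omega> \<in> carrier_mat n n" "X \<in> carrier_mat n n" "Y \<in> carrier_mat n n"
  shows "X * ad \<Omega> Y + ad \<Omega> X * Y = ad \<Omega> (X * Y)"
proof -
  have c: "X * (Y * \<Omega>) \<in> carrier_mat n n" "X * (\<Omega> * Y) \<in> carrier_mat n n" "\<Omega> * (X * Y) \<in> carrier_mat n n"
    using assms by (auto intro!: mult_carrier_mat)
  have "X * ad \<Omega> Y + ad \<Omega> X * Y = X * (\<Omega> * Y) - X * (Y * \<Omega>) + (\<Omega> * (X * Y) - X * (\<Omega> * Y))"
    using assms by (simp add: ad_def mat_distribs[where n=n])
  also have "\<dots> = \<Omega> * (X * Y) - X * (Y * \<Omega>)" using c by (intro mat_cancel)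
  finally show ?thesis using assms by (simp add: ad_def mat_distribs[where n=n])
qed

lemma ad_minus:
  assumes "\<Omega> \<in> carrier_mat n n" "X \<in> carrier_mat n n" "Y \<in> carrier_mat n n"
  shows "ad \<Omega> X - ad \<Omega> Y = ad \<Omega> (X - Y)"
proof -
  have c: "X - Y \<in> carrier_mat n n" using assms by (auto intro: minus_carrier_mat)
  show ?thesis
  proof (rule eq_matI)
    fix a b assume "a < dim_row (ad \<Omega> (X - Y))" "b < dim_col (ad \<Omega> (X - Y))"
    then have ab: "a < n" "b < n" using assms c by (auto simp: ad_def)
    have "(ad \<Omega> X - ad \<Omega> Y) $$ (a, b) = ad \<Omega> X $$ (a, b) - ad \<Omega> Y $$ (a, b)"
      using ab assms by (auto simp: ad_def)
    also have "\<dots> = ad \<Omega> (X - Y) $$ (a, b)"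
      unfolding ad_index[OF assms(1,2) ab] ad_index[OF assms(1,3) ab] ad_index[OF assms(1) c ab]
      using assms ab by (auto simp flip: sum_subtractf intro!: sum.cong simp: algebra_simps)
    finally show "(ad \<Omega> X - ad \<Omega> Y) $$ (a, b) = ad \<Omega> (X - Y) $$ (a, b)" .
  qed (use assms in \<open>auto simp: ad_def\<close>)
qed

lemma GrD: 
  assumes "P \<in> Gr m n"
  shows "P \<in> her n" "P \<in> carrier_mat n n" "P * P = P" "mtrace P = of_nat m"
  using assms by (auto simp: Gr_def her_def)

text \<open>
  With \<open>c = flow \<Omega> P 0\<close>, the defect \<open>D = c c - c\<close> satisfies \<open>D' = ad \<Omega> D\<close>, because \<open>ad \<Omega>\<close> is a
  derivation. The same equation then holds for \<open>D D\<close>, and commutators have trace zero, so the squared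
  norm \<open>mtrace (D D)\<close> is constant. It vanishes at the start. The trace of \<open>c\<close> is constant for the
  same reason.
\<close>

lemma flow_Gr:
  assumes \<Omega>: "\<Omega> \<in> skew n" and P: "P \<in> Gr m n"
  shows "flow \<Omega> P 0 t \<in> Gr m n"
proof -
  have \<Omega>c: "\<Omega> \<in> carrier_mat n n" using \<Omega> by (simp add: skew_def)
  note Pc = GrD(2)[OF P]
  define c where "c = flow \<Omega> P 0"
  define D where "D t = c t * c t - c t" for t
  have c: "c t \<in> carrier_mat n n" for t using Pc by (simp add: c_def)
  have cc: "c t * c t \<in> carrier_mat n n" for t using c by (auto intro: mult_carrier_mat)
  have ch: "mat_adjoint (c t) = c t" for t
    using flow_her[OF \<Omega> GrD(1)[OF P]] by (simp add: c_def her_def)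
  have c0: "c 0 = P" unfolding c_def by (rule flow_0[OF Pc])
  have c': "mat_deriv n c (ad \<Omega> (c t)) t" for t
    using flow_deriv[OF \<Omega>c Pc, of 0 t] unfolding flow_Suc[OF \<Omega>c Pc] c_def .
  have D: "D t \<in> carrier_mat n n" for t unfolding D_def by (auto intro: minus_carrier_mat c)
  have D': "mat_deriv n D (ad \<Omega> (D t)) t" for t
    using mat_deriv_minus[OF mat_deriv_mult[OF c' c'] c', of t]
    unfolding ad_mult[OF \<Omega>c c c] ad_minus[OF \<Omega>c cc c] D_def .
  have DD': "mat_deriv n (\<lambda>t. D t * D t) (ad \<Omega> (D t * D t)) t" for t
    using mat_deriv_mult[OF D' D', of t] unfolding ad_mult[OF \<Omega>c D D] .
  have "((\<lambda>t. mtrace (D t * D t)) has_vector_derivative 0) (at t)" for t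
    using mat_deriv_mtrace[OF DD', of t] mtrace_ad_0[OF \<Omega>c, of "D t * D t"] D[of t]
    by (simp add: mult_carrier_mat)
  then have "mtrace (D t * D t) = mtrace (D 0 * D 0)" by (rule complex_zero_derivative_constant)
  moreover have "D 0 = 0\<^sub>m n n" unfolding D_def c0 GrD(3)[OF P] using Pc by simp
  ultimately have "mtrace (D t * D t) = 0" by (simp add: mtrace_def)
  moreover have "D t \<in> her n"
    using D[of t] c[of t] cc[of t] ch[of t]
    by (simp add: her_def D_def mat_adjoint_minus[of _ n n] mat_adjoint_mult[of _ n n _ n])
  ultimately have D0: "D t = 0\<^sub>m n n" using trace_her_sq_eq_0 by simp
  have idem: "c t = c t * c t"
  proof (rule eq_matI)
    fix i k assume "i < dim_row (c t * c t)" "k < dim_col (c t * c t)"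
    then have ik: "i < n" "k < n" using cc[of t] by auto
    have "D t $$ (i, k) = 0" using D0 ik by simp
    then show "c t $$ (i, k) = (c t * c t) $$ (i, k)"
      unfolding D_def using ik c[of t] cc[of t] by (simp del: index_mult_mat(1))
  qed (use c[of t] in auto)
  have "((\<lambda>t. mtrace (c t)) has_vector_derivative 0) (at t)" for t
    using mat_deriv_mtrace[OF c', of t] mtrace_ad_0[OF \<Omega>c c, of t] by simp
  then have "mtrace (c t) = mtrace (c 0)" by (rule complex_zero_derivative_constant)
  then have "mtrace (c t) = of_nat m" unfolding c0 GrD(4)[OF P] .
  then show ?thesis unfolding Gr_def using c ch idem by (simp add: c_def)
qed

section \<open>Tangent spaces of products of Grassmannians\<close>

lemma Gr_prodD:
  assumes "p \<in> Gr_prod ms ns" "j < length ns"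
  shows "p ! j \<in> Gr (ms ! j) (ns ! j)" "length p = length ns"
  using assms by (auto simp: Gr_prod_def)

lemma Gr_prod_her_prod: "Gr_prod ms ns \<subseteq> her_prod ns"
  by (auto simp: Gr_prod_def her_prod_def intro: GrD)

definition skew_prod :: "nat list \<Rightarrow> tuple set" where
  "skew_prod ns = {\<Omega>. length \<Omega> = length ns \<and> (\<forall>j<length ns. \<Omega> ! j \<in> skew (ns ! j))}"

text \<open>
  The slotwise commutator. For a fixed tuple \<open>\<Omega>\<close> of skew-Hermitian matrices, \<open>tad \<Omega>\<close> is the Killing
  field of a one-parameter group of unitary conjugations.
\<close>

definition tad :: "tuple \<Rightarrow> tuple \<Rightarrow> tuple" where
  "tad X Y = map2 ad X Y"

lemma length_tad [simp]: "length (tad X Y) = min (length X) (length Y)"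
  by (simp add: tad_def)

lemma nth_tad [simp]: "j < length X \<Longrightarrow> j < length Y \<Longrightarrow> tad X Y ! j = ad (X ! j) (Y ! j)"
  by (simp add: tad_def)

lemma skew_prodD:
  assumes "\<Omega> \<in> skew_prod ns" "j < length ns"
  shows "\<Omega> ! j \<in> skew (ns ! j)" "\<Omega> ! j \<in> carrier_mat (ns ! j) (ns ! j)" "length \<Omega> = length ns"
  using assms by (auto simp: skew_prod_def skew_def)

lemma tad_her_her: "X \<in> her_prod ns \<Longrightarrow> Y \<in> her_prod ns \<Longrightarrow> tad X Y \<in> skew_prod ns"
  by (auto simp: skew_prod_def her_prod_def intro: ad_her_her)

lemma tad_skew_her: "X \<in> skew_prod ns \<Longrightarrow> Y \<in> her_prod ns \<Longrightarrow> tad X Y \<in> her_prod ns"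
  by (auto simp: skew_prod_def her_prod_def intro: ad_skew_her)

definition Gr_tangent :: "nat list \<Rightarrow> tuple \<Rightarrow> tuple set" where
  "Gr_tangent ns p = {V \<in> her_prod ns. \<forall>j<length ns. V ! j = p ! j * V ! j + V ! j * p ! j}"

lemma tad_Gr_tangent:
  assumes p: "p \<in> Gr_prod ms ns" and \<Omega>: "\<Omega> \<in> skew_prod ns"
  shows "tad \<Omega> p \<in> Gr_tangent ns p"
proof -
  have "ad (\<Omega> ! j) (p ! j) = p ! j * ad (\<Omega> ! j) (p ! j) + ad (\<Omega> ! j) (p ! j) * p ! j" if j: "j < length ns" for j
    using GrD[OF Gr_prodD(1)[OF p j]] skew_prodD[OF \<Omega> j] by (intro ad_off_diagonal)
  moreover have "length p = length ns" "length \<Omega> = length ns"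
    using p \<Omega> by (auto simp: Gr_prod_def skew_prod_def)
  ultimately show ?thesis
    unfolding Gr_tangent_def using tad_skew_her[OF \<Omega> subsetD[OF Gr_prod_her_prod p]] by auto
qed

text \<open>
  Every tangent vector at \<open>p\<close> is the value at \<open>p\<close> of a Killing field.
\<close>

lemma tad_tad_tangent:
  assumes p: "p \<in> Gr_prod ms ns" and V: "V \<in> Gr_tangent ns p"
  shows "tad (tad V p) p = V"
proof (rule nth_equalityI)
  have l: "length p = length ns" "length V = length ns" using p V by (auto simp: Gr_prod_def Gr_tangent_def her_prod_def)
  then show "length (tad (tad V p) p) = length V" by simp
  fix j assume "j < length (tad (tad V p) p)"
  then have j: "j < length ns" using l by simp
  have "ad (ad (V ! j) (p ! j)) (p ! j) = V ! j"
    using V j unfolding Gr_tangent_def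
    by (intro ad_ad_off_diagonal[OF GrD(2,3)[OF Gr_prodD(1)[OF p j]]] her_prodD(2)[of V ns j]) blast+
  then show "tad (tad V p) p ! j = V ! j" using l j by simp
qed

text \<open>
  The integral curves of a Killing field stay in the manifold. That the velocity is known along the
  whole curve, not only at \<open>p\<close>, makes second derivatives along it accessible.
\<close>

lemma Gr_curve:
  assumes p: "p \<in> Gr_prod ms ns" and \<Omega>: "\<Omega> \<in> skew_prod ns"
  shows "\<exists>c. curve_through ns (Gr_prod ms ns) p (tad \<Omega> p) c \<and> (\<forall>t. curve_deriv ns c t (tad \<Omega> (c t)))"
proof -
  define g where "g k t = map (\<lambda>j. flow (\<Omega> ! j) (p ! j) k t) [0..<length ns]" for k t
  have l: "length p = length ns" "length \<Omega> = length ns" "length (g k t) = length ns" for k t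
    using p \<Omega> by (auto simp: Gr_prod_def skew_prod_def g_def)
  have gj: "g k t ! j = flow (\<Omega> ! j) (p ! j) k t" if "j < length ns" for k t j
    using that by (simp add: g_def)
  have gH: "g k t \<in> her_prod ns" for k t
    unfolding her_prod_def using l gj flow_her[OF skew_prodD(1)[OF \<Omega>] GrD(1)[OF Gr_prodD(1)[OF p]]] by auto
  have gd: "curve_deriv ns (g k) t (g (Suc k) t)" for k t
    unfolding curve_deriv_def
    using gH gj flow_deriv[OF skew_prodD(2)[OF \<Omega>] GrD(2)[OF Gr_prodD(1)[OF p]]]
    by (auto simp: mat_deriv_def)
  have gM: "g 0 t \<in> Gr_prod ms ns" for t
    unfolding Gr_prod_def using l gj flow_Gr[OF skew_prodD(1)[OF \<Omega>] Gr_prodD(1)[OF p]] by auto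
  have g0: "g 0 0 = p"
    using l gj flow_0[OF GrD(2)[OF Gr_prodD(1)[OF p]]] by (intro nth_equalityI) auto
  have g1: "g (Suc k) t = tad \<Omega> (g k t)" for k t
    using l gj flow_Suc[OF skew_prodD(2)[OF \<Omega>] GrD(2)[OF Gr_prodD(1)[OF p]]] by (intro nth_equalityI) auto
  have "smooth_curve ns (Gr_prod ms ns) (g 0)"
    unfolding smooth_curve_def using gM gd by blast
  moreover have d: "curve_deriv ns (g 0) t (tad \<Omega> (g 0 t))" for t
    using gd[of 0 t] unfolding g1 .
  moreover have "curve_deriv ns (g 0) 0 (tad \<Omega> p)" using d[of 0] unfolding g0 .
  ultimately show ?thesis unfolding curve_through_def using g0 by blast
qed

text \<open>
  One inclusion differentiates \<open>c = c c\<close>, the other uses the curves \<open>Gr_curve\<close>.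
\<close>

lemma tangent_space_Gr:
  assumes p: "p \<in> Gr_prod ms ns"
  shows "tangent_space ns (Gr_prod ms ns) p = Gr_tangent ns p"
proof
  show "Gr_tangent ns p \<subseteq> tangent_space ns (Gr_prod ms ns) p"
  proof
    fix V assume V: "V \<in> Gr_tangent ns p"
    have "tad V p \<in> skew_prod ns"
      using V p Gr_prod_her_prod by (intro tad_her_her) (auto simp: Gr_tangent_def)
    from Gr_curve[OF p this] show "V \<in> tangent_space ns (Gr_prod ms ns) p"
      unfolding tad_tad_tangent[OF p V] tangent_space_def by blast
  qed
  show "tangent_space ns (Gr_prod ms ns) p \<subseteq> Gr_tangent ns p"
  proof
    fix V assume "V \<in> tangent_space ns (Gr_prod ms ns) p"
    then obtain c where c: "\<And>t. c t \<in> Gr_prod ms ns" "c 0 = p" "curve_deriv ns c 0 V"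
      unfolding tangent_space_def curve_through_def smooth_curve_def by blast
    have V: "V \<in> her_prod ns" using c(3) by (simp add: curve_deriv_def)
    have "V ! j = p ! j * V ! j + V ! j * p ! j" if j: "j < length ns" for j
    proof (rule eq_matI)
      note G = GrD[OF Gr_prodD(1)[OF c(1) j]]
      have d: "mat_deriv (ns ! j) (\<lambda>s. c s ! j) (V ! j) 0"
        using c(3) j G(2) her_prodD(2)[OF V j] by (auto simp: mat_deriv_def curve_deriv_def)
      have d2: "mat_deriv (ns ! j) (\<lambda>s. c s ! j) (p ! j * V ! j + V ! j * p ! j) 0"
        using mat_deriv_mult[OF d d] unfolding G(3) c(2) .
      have C: "p ! j * V ! j + V ! j * p ! j \<in> carrier_mat (ns ! j) (ns ! j)"
        using d2 by (simp add: mat_deriv_def)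
      show "dim_row (V ! j) = dim_row (p ! j * V ! j + V ! j * p ! j)"
        "dim_col (V ! j) = dim_col (p ! j * V ! j + V ! j * p ! j)"
        using C her_prodD(2)[OF V j] by auto
      fix a b assume "a < dim_row (p ! j * V ! j + V ! j * p ! j)" "b < dim_col (p ! j * V ! j + V ! j * p ! j)"
      then have ab: "a < ns ! j" "b < ns ! j" using C by auto
      have "((\<lambda>s. (c s ! j) $$ (a, b)) has_vector_derivative (V ! j) $$ (a, b)) (at 0)"
        "((\<lambda>s. (c s ! j) $$ (a, b)) has_vector_derivative
          (p ! j * V ! j + V ! j * p ! j) $$ (a, b)) (at 0)"
        using d d2 ab unfolding mat_deriv_def by blast+
      then show "(V ! j) $$ (a, b) = (p ! j * V ! j + V ! j * p ! j) $$ (a, b)"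
        by (rule has_vector_derivative_unique)
    qed
    with V show "V \<in> Gr_tangent ns p" by (simp add: Gr_tangent_def)
  qed
qed

section \<open>The gradient of the Rayleigh-quotient\<close>

text \<open>
  The differential of the generalized Rayleigh-quotient, by multilinearity.
\<close>

definition rayleigh_diff :: "complex mat \<Rightarrow> tuple \<Rightarrow> tuple \<Rightarrow> real" where
  "rayleigh_diff A q V = (\<Sum>j<length q. Re (kron_trace A (q[j := V ! j])))"

lemma rayleigh_derivative:
  assumes A: "A \<in> carrier_mat (prod_list ns) (prod_list ns)"
    and c: "\<And>s. c s \<in> her_prod ns" and d: "curve_deriv ns c t \<xi>"
  shows "((\<lambda>s. rayleigh A (c s)) has_real_derivative rayleigh_diff A (c t) \<xi>) (at t)"
  using has_real_derivative_Re[OF kron_trace_derivative[OF A c d]] her_prod_length[OF c[of t]]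
  by (simp add: rayleigh_eq rayleigh_diff_def)

lemma tangent_deriv_rayleigh:
  assumes A: "A \<in> carrier_mat (prod_list ns) (prod_list ns)"
    and M: "M \<subseteq> her_prod ns" and \<xi>: "\<xi> \<in> tangent_space ns M q"
  shows "tangent_deriv ns M (rayleigh A) q \<xi> = rayleigh_diff A q \<xi>"
proof (rule tangent_deriv_eqI[OF \<xi>])
  fix c assume c: "curve_through ns M q \<xi> c"
  have "((\<lambda>s. rayleigh A (c s)) has_real_derivative rayleigh_diff A (c 0) \<xi>) (at 0)"
    using c M by (intro rayleigh_derivative[OF A]) (auto simp: curve_through_def smooth_curve_def)
  then show "((\<lambda>s. rayleigh A (c s)) has_real_derivative rayleigh_diff A q \<xi>) (at 0)"
    using c by (simp add: curve_through_def)
qed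

text \<open>
  Passing to the Hermitian part of \<^const>\<open>Ahat\<close> makes the gradient a Hermitian tuple by construction.
  It does not change the real parts of traces against Hermitian matrices.
\<close>

definition her_part :: "complex mat \<Rightarrow> complex mat" where
  "her_part E = complex_of_real (1/2) \<cdot>\<^sub>m (E + mat_adjoint E)"

lemma her_part_her: 
  assumes "E \<in> carrier_mat n n" shows "her_part E \<in> her n"
proof -
  have "E + mat_adjoint E \<in> her n"
    using assms by (simp add: her_def mat_adjoint_add[of _ n n] comm_add_mat[of _ n n])
  then show ?thesis unfolding her_part_def by (rule her_smult)
qed

lemma Re_mtrace_her_part:
  assumes E: "E \<in> carrier_mat n n" and V: "V \<in> her n"
  shows "Re (mtrace (her_part E * V)) = Re (mtrace (E * V))"
proof -
  have c: "V \<in> carrier_mat n n" "mat_adjoint E \<in> carrier_mat n n" "mat_adjoint V = V"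
    using V E by (auto simp: her_def)
  have "mtrace (mat_adjoint E * V) = mtrace (mat_adjoint (V * E))"
    using c E by (simp add: mat_adjoint_mult[of _ n n])
  also have "\<dots> = cnj (mtrace (E * V))"
    using c E mtrace_comm[OF c(1) E] by (simp add: mtrace_adjoint[of _ n])
  finally have 1: "mtrace (mat_adjoint E * V) = cnj (mtrace (E * V))" .
  have "her_part E * V = complex_of_real (1/2) \<cdot>\<^sub>m (E * V + mat_adjoint E * V)"
    unfolding her_part_def using c E
    by (simp add: mult_smult_assoc_mat[of _ n n] add_mult_distrib_mat[of _ n n])
  then have "mtrace (her_part E * V) = complex_of_real (1/2) * (mtrace (E * V) + mtrace (mat_adjoint E * V))"
    using c E mult_carrier_mat[OF E c(1)] mult_carrier_mat[OF c(2,1)]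
    by (simp only: mtrace_smult[of _ n] mtrace_add[of _ n] add_carrier_mat)
  then have "mtrace (her_part E * V) = complex_of_real (Re (mtrace (E * V)))"
    unfolding 1 complex_add_cnj by simp
  then show ?thesis by simp
qed

text \<open>
  The Euclidean gradient has the slots \<open>her_part (Ahat ns A q j)\<close>; the double commutator projects it
  onto the tangent space.
\<close>

definition gradient :: "nat list \<Rightarrow> complex mat \<Rightarrow> tuple \<Rightarrow> tuple" where
  "gradient ns A q = tad (tad (map (\<lambda>j. her_part (Ahat ns A q j)) [0..<length ns]) q) q"

lemma Ahat_tuple_her_prod:
  assumes A: "A \<in> carrier_mat (prod_list ns) (prod_list ns)" and q: "q \<in> her_prod ns"
  shows "map (\<lambda>j. her_part (Ahat ns A q j)) [0..<length ns] \<in> her_prod ns"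
  using Ahat(1)[OF A her_prod_sq_prod[OF q]] by (auto simp: her_prod_def intro: her_part_her)

lemma gradient_tangent:
  assumes A: "A \<in> carrier_mat (prod_list ns) (prod_list ns)" and q: "q \<in> Gr_prod ms ns"
  shows "gradient ns A q \<in> Gr_tangent ns q"
  unfolding gradient_def using q Gr_prod_her_prod
  by (intro tad_Gr_tangent[OF q] tad_her_her Ahat_tuple_her_prod[OF A]) auto

text \<open>
  Moving the projection to \<open>V\<close> turns the inner product into a polynomial in \<open>q\<close>, although
  \<^const>\<open>Ahat\<close> is only given by a description. This is how smoothness of the gradient is obtained.
\<close>

lemma tinner_gradient:
  assumes A: "A \<in> carrier_mat (prod_list ns) (prod_list ns)" and q: "q \<in> her_prod ns"
    and V: "V \<in> her_prod ns"
  shows "tinner (gradient ns A q) V = rayleigh_diff A q (tad (tad V q) q)"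
proof -
  have l: "length q = length ns" "length V = length ns" "length (gradient ns A q) = length ns"
    using q V by (auto simp: her_prod_length gradient_def)
  have "Re (mtrace (gradient ns A q ! j * V ! j)) = Re (kron_trace A (q[j := tad (tad V q) q ! j]))"
    if j: "j < length ns" for j
  proof -
    note E = Ahat(1)[OF A her_prod_sq_prod[OF q] j]
    note c = her_carrier[OF her_part_her[OF E]] her_prodD(2)[OF V j] her_prodD(2)[OF q j]
    have h: "ad (ad (V ! j) (q ! j)) (q ! j) \<in> her (ns ! j)"
      by (intro ad_skew_her ad_her_her her_prodD(1)[OF V j] her_prodD(1)[OF q j])
    have "mtrace (gradient ns A q ! j * V ! j) = mtrace (her_part (Ahat ns A q j) * ad (ad (V ! j) (q ! j)) (q ! j))"
      using mtrace_ad_ad[OF c] j l by (simp add: gradient_def)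
    also have "Re \<dots> = Re (mtrace (Ahat ns A q j * ad (ad (V ! j) (q ! j)) (q ! j)))"
      by (rule Re_mtrace_her_part[OF E h])
    also have "\<dots> = Re (kron_trace A (q[j := ad (ad (V ! j) (q ! j)) (q ! j)]))"
      using Ahat(2)[OF A her_prod_sq_prod[OF q] j her_carrier[OF h]] by simp
    finally show ?thesis using j l by simp
  qed
  then show ?thesis unfolding tinner_def rayleigh_diff_def l by simp
qed

lemma tinner_gradient_tangent:
  assumes A: "A \<in> carrier_mat (prod_list ns) (prod_list ns)" and q: "q \<in> Gr_prod ms ns"
    and V: "V \<in> Gr_tangent ns q"
  shows "tinner (gradient ns A q) V = rayleigh_diff A q V"
  using tinner_gradient[OF A, of q V] tad_tad_tangent[OF q V] q V Gr_prod_her_prod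
  by (auto simp: Gr_tangent_def)

lemma mat_combination:
  fixes A B C D :: "complex mat"
  assumes "A \<in> carrier_mat n n" "B \<in> carrier_mat n n" "C \<in> carrier_mat n n" "D \<in> carrier_mat n n"
  shows "(a \<cdot>\<^sub>m A + b \<cdot>\<^sub>m C) + (a \<cdot>\<^sub>m B + b \<cdot>\<^sub>m D) = a \<cdot>\<^sub>m (A + B) + b \<cdot>\<^sub>m (C + D)"
  using assms by (intro eq_matI) (auto simp: algebra_simps)

lemma Gr_tangent_linear:
  assumes p: "p \<in> Gr_prod ms ns" and X: "X \<in> Gr_tangent ns p" and Y: "Y \<in> Gr_tangent ns p"
  shows "tadd (tscale a X) (tscale b Y) \<in> Gr_tangent ns p"
proof -
  have H: "X \<in> her_prod ns" "Y \<in> her_prod ns" using X Y by (auto simp: Gr_tangent_def)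
  have l: "length X = length ns" "length Y = length ns" using H by (auto simp: her_prod_length)
  have "tadd (tscale a X) (tscale b Y) ! j =
      p ! j * tadd (tscale a X) (tscale b Y) ! j + tadd (tscale a X) (tscale b Y) ! j * p ! j"
    if j: "j < length ns" for j
  proof -
    let ?n = "ns ! j" and ?P = "p ! j" and ?x = "X ! j" and ?y = "Y ! j"
    note P = GrD(2)[OF Gr_prodD(1)[OF p j]]
    note c = her_prodD(2)[OF H(1) j] her_prodD(2)[OF H(2) j]
    have e: "?x = ?P * ?x + ?x * ?P" "?y = ?P * ?y + ?y * ?P"
      using X Y j unfolding Gr_tangent_def by blast+
    have d: "?P * ?x \<in> carrier_mat ?n ?n" "?x * ?P \<in> carrier_mat ?n ?n"
      "?P * ?y \<in> carrier_mat ?n ?n" "?y * ?P \<in> carrier_mat ?n ?n"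
      using P c by (auto intro: mult_carrier_mat)
    let ?a = "complex_of_real a" and ?b = "complex_of_real b"
    have "?P * (?a \<cdot>\<^sub>m ?x + ?b \<cdot>\<^sub>m ?y) + (?a \<cdot>\<^sub>m ?x + ?b \<cdot>\<^sub>m ?y) * ?P =
        (?a \<cdot>\<^sub>m (?P * ?x) + ?b \<cdot>\<^sub>m (?P * ?y)) + (?a \<cdot>\<^sub>m (?x * ?P) + ?b \<cdot>\<^sub>m (?y * ?P))"
      using P c by (simp add: mat_distribs[where n = ?n] mult_smult_distrib[of _ ?n ?n]
          mult_smult_assoc_mat[of _ ?n ?n])
    also have "\<dots> = ?a \<cdot>\<^sub>m (?P * ?x + ?x * ?P) + ?b \<cdot>\<^sub>m (?P * ?y + ?y * ?P)"
      using d by (intro mat_combination)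
    also have "\<dots> = ?a \<cdot>\<^sub>m ?x + ?b \<cdot>\<^sub>m ?y" unfolding e[symmetric] ..
    finally show ?thesis using j l by simp
  qed
  then show ?thesis unfolding Gr_tangent_def using H by (auto intro: her_prod_tadd her_prod_tscale)
qed

lemma rgrad_rayleigh:
  assumes A: "A \<in> carrier_mat (prod_list ns) (prod_list ns)" and q: "q \<in> Gr_prod ms ns"
  shows "rgrad ns (Gr_prod ms ns) (rayleigh A) q = gradient ns A q"
proof -
  let ?G = "gradient ns A q"
  note G = gradient_tangent[OF A q]
  show ?thesis
    unfolding rgrad_def tangent_space_Gr[OF q]
  proof (rule the_equality)
    show "?G \<in> Gr_tangent ns q \<and> (\<forall>\<xi>\<in>Gr_tangent ns q. tinner ?G \<xi> = tangent_deriv ns (Gr_prod ms ns) (rayleigh A) q \<xi>)"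
      using G tinner_gradient_tangent[OF A q] tangent_space_Gr[OF q] tangent_deriv_rayleigh[OF A Gr_prod_her_prod] by auto
    fix v assume v: "v \<in> Gr_tangent ns q \<and> (\<forall>\<xi>\<in>Gr_tangent ns q. tinner v \<xi> = tangent_deriv ns (Gr_prod ms ns) (rayleigh A) q \<xi>)"
    \<comment> \<open>The difference is itself tangent, hence may be used as a test vector.\<close>
    let ?D = "tadd (tscale 1 v) (tscale (- 1) ?G)"
    have D: "?D \<in> Gr_tangent ns q" using v G by (intro Gr_tangent_linear[OF q]) auto
    have H: "v \<in> her_prod ns" "?G \<in> her_prod ns" "?D \<in> her_prod ns"
      using v G D by (auto simp: Gr_tangent_def)
    have "tinner v ?D = tinner ?G ?D"
      using v D tinner_gradient_tangent[OF A q D] tangent_space_Gr[OF q] tangent_deriv_rayleigh[OF A Gr_prod_her_prod] by auto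
    then have "tinner ?D ?D = 0" by (simp add: tinner_linear_left[OF H])
    then show "v = ?G" by (rule tuple_eq_if_tinner_diff_0[OF H(1,2)])
  qed
qed

section \<open>Smoothness of the gradient and of Killing fields\<close>

lemma polyfun_ad:
  assumes "\<And>X. X \<in> her_prod ns \<Longrightarrow> F X \<in> carrier_mat n n" "\<And>X. X \<in> her_prod ns \<Longrightarrow> G X \<in> carrier_mat n n"
    and "\<And>i k. i < n \<Longrightarrow> k < n \<Longrightarrow> polyfun ns (\<lambda>X. F X $$ (i, k))"
    and "\<And>i k. i < n \<Longrightarrow> k < n \<Longrightarrow> polyfun ns (\<lambda>X. G X $$ (i, k))"
    and ik: "i < n" "k < n"
  shows "polyfun ns (\<lambda>X. ad (F X) (G X) $$ (i, k))"
proof (rule polyfun.cong)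
  show "polyfun ns (\<lambda>X. \<Sum>l<n. F X $$ (i, l) * G X $$ (l, k) - G X $$ (i, l) * F X $$ (l, k))"
    using assms by (intro polyfun_sum polyfun_diff polyfun.mult) auto
qed (simp add: ad_index[OF assms(1,2) ik])

lemma polyfun_rayleigh_diff:
  assumes A: "A \<in> carrier_mat (prod_list ns) (prod_list ns)"
    and W: "\<And>X. X \<in> her_prod ns \<Longrightarrow> W X \<in> her_prod ns"
    and p: "\<And>j i k. j < length ns \<Longrightarrow> i < ns ! j \<Longrightarrow> k < ns ! j \<Longrightarrow> polyfun ns (\<lambda>X. (W X ! j) $$ (i, k))"
  shows "\<exists>f. polyfun ns f \<and> (\<forall>X\<in>her_prod ns. rayleigh_diff A X (W X) = Re (f X))"
proof (intro exI conjI ballI)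
  show "polyfun ns (\<lambda>X. \<Sum>j<length ns. kron_trace A (X[j := W X ! j]))"
  proof (intro polyfun_sum polyfun_kron_trace[OF A])
    fix j X assume "j \<in> {..<length ns}" "X \<in> her_prod ns"
    then show "X[j := W X ! j] \<in> sq_prod ns"
      by (intro sq_prod_update her_prod_sq_prod her_prodD(2)[OF W]) auto
  next
    fix j l i k assume j: "j \<in> {..<length ns}" and l: "l < length ns" "i < ns ! l" "k < ns ! l"
    show "polyfun ns (\<lambda>X. (X[j := W X ! j] ! l) $$ (i, k))"
    proof (rule polyfun.cong)
      show "polyfun ns (\<lambda>X. if j = l then (W X ! l) $$ (i, k) else (X ! l) $$ (i, k))"
        using l by (cases "j = l") (auto intro: p polyfun.entry)
    qed (use l in \<open>auto simp: her_prod_length nth_list_update\<close>)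
  qed
  show "rayleigh_diff A X (W X) = Re (\<Sum>j<length ns. kron_trace A (X[j := W X ! j]))" if "X \<in> her_prod ns" for X
    using that by (simp add: rayleigh_diff_def her_prod_length)
qed

lemma polyfun_tad_const:
  assumes \<Omega>: "\<Omega> \<in> skew_prod ns" and "j < length ns" "i < ns ! j" "k < ns ! j"
  shows "polyfun ns (\<lambda>X. (tad \<Omega> X ! j) $$ (i, k))"
proof (rule polyfun.cong)
  show "polyfun ns (\<lambda>X. ad (\<Omega> ! j) (X ! j) $$ (i, k))"
    using assms by (intro polyfun_ad[where n = "ns ! j"] polyfun.const polyfun.entry her_prodD(2) skew_prodD(2)) auto
qed (use assms skew_prodD(3)[OF \<Omega>] in \<open>simp add: her_prod_length\<close>)

lemma tad_vector_field:
  assumes \<Omega>: "\<Omega> \<in> skew_prod ns"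
  shows "tad \<Omega> \<in> vector_fields ns (Gr_prod ms ns)"
  unfolding vector_fields_def
proof (intro CollectI conjI ballI)
  show "tad \<Omega> p \<in> tangent_space ns (Gr_prod ms ns) p" if "p \<in> Gr_prod ms ns" for p
    using tad_Gr_tangent[OF that \<Omega>] tangent_space_Gr[OF that] by simp
  fix V assume V: "V \<in> her_prod ns"
  show "smooth_fun ns (Gr_prod ms ns) (\<lambda>p. tinner (tad \<Omega> p) V)"
  proof (rule smooth_fun_polyfun[OF _ Gr_prod_her_prod])
    show "polyfun ns (\<lambda>X. \<Sum>j<length ns. \<Sum>i<ns ! j. \<Sum>k<ns ! j. (tad \<Omega> X ! j) $$ (i, k) * (V ! j) $$ (k, i))"
      by (intro polyfun_sum polyfun.mult polyfun.const polyfun_tad_const[OF \<Omega>]) auto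
    fix q assume "q \<in> Gr_prod ms ns"
    then have q: "q \<in> her_prod ns" using Gr_prod_her_prod by blast
    note t = tad_skew_her[OF \<Omega> q]
    show "tinner (tad \<Omega> q) V =
        Re (\<Sum>j<length ns. \<Sum>i<ns ! j. \<Sum>k<ns ! j. (tad \<Omega> q ! j) $$ (i, k) * (V ! j) $$ (k, i))"
      unfolding tinner_def her_prod_length[OF t]
      using mtrace_mult[OF her_prodD(2)[OF t] her_prodD(2)[OF V]] by simp
  qed
qed

lemma rgrad_vector_field:
  assumes A: "A \<in> carrier_mat (prod_list ns) (prod_list ns)"
  shows "rgrad ns (Gr_prod ms ns) (rayleigh A) \<in> vector_fields ns (Gr_prod ms ns)"
  unfolding vector_fields_def
proof (intro CollectI conjI ballI)
  show "rgrad ns (Gr_prod ms ns) (rayleigh A) p \<in> tangent_space ns (Gr_prod ms ns) p" if "p \<in> Gr_prod ms ns" for p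
    unfolding rgrad_rayleigh[OF A that] tangent_space_Gr[OF that] by (rule gradient_tangent[OF A that])
  fix V assume V: "V \<in> her_prod ns"
  have W: "tad (tad V X) X \<in> her_prod ns" if "X \<in> her_prod ns" for X
    by (intro tad_skew_her tad_her_her V that)
  have "polyfun ns (\<lambda>X. (tad (tad V X) X ! j) $$ (i, k))" if j: "j < length ns" and ik: "i < ns ! j" "k < ns ! j" for j i k
  proof (rule polyfun.cong)
    show "polyfun ns (\<lambda>X. ad (ad (V ! j) (X ! j)) (X ! j) $$ (i, k))"
      using j ik V
      by (intro polyfun_ad[where n = "ns ! j"] ad_carrier polyfun.const polyfun.entry her_prodD(2)) auto
  qed (use j V in \<open>simp add: her_prod_length\<close>)
  then obtain f where f: "polyfun ns f" "\<And>X. X \<in> her_prod ns \<Longrightarrow> rayleigh_diff A X (tad (tad V X) X) = Re (f X)"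
    using polyfun_rayleigh_diff[OF A, of "\<lambda>X. tad (tad V X) X"] W by blast
  show "smooth_fun ns (Gr_prod ms ns) (\<lambda>p. tinner (rgrad ns (Gr_prod ms ns) (rayleigh A) p) V)"
  proof (rule smooth_fun_polyfun[OF f(1) Gr_prod_her_prod])
    fix q assume q: "q \<in> Gr_prod ms ns"
    then have qh: "q \<in> her_prod ns" using Gr_prod_her_prod by blast
    show "tinner (rgrad ns (Gr_prod ms ns) (rayleigh A) q) V = Re (f q)"
      unfolding rgrad_rayleigh[OF A q] tinner_gradient[OF A qh V] f(2)[OF qh] ..
  qed
qed

lemma smooth_fun_rayleigh:
  assumes A: "A \<in> carrier_mat (prod_list ns) (prod_list ns)"
  shows "smooth_fun ns (Gr_prod ms ns) (rayleigh A)"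
proof (rule smooth_fun_polyfun[OF _ Gr_prod_her_prod])
  show "polyfun ns (kron_trace A)"
    using polyfun_kron_trace[OF A her_prod_sq_prod polyfun.entry] by simp
qed (simp add: rayleigh_eq)

section \<open>The Hessian at an extremum\<close>

text \<open>
  If \<open>d\<close> were positive, \<open>f'\<close> would be positive just to the right of \<open>0\<close> and the mean value theorem
  would give larger values of \<open>f\<close> there.
\<close>

lemma second_derivative_test:
  fixes f f' :: "real \<Rightarrow> real"
  assumes f: "\<And>t. (f has_real_derivative f' t) (at t)" and f': "(f' has_real_derivative d) (at 0)"
    and max: "\<delta> > 0" "\<And>t. \<bar>t\<bar> < \<delta> \<Longrightarrow> f t \<le> f 0"
  shows "f' 0 = 0" "d \<le> 0"
proof -
  show 0: "f' 0 = 0" using DERIV_local_max[OF f[of 0] max(1)] max(2) by simp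
  show "d \<le> 0"
  proof (rule ccontr)
    assume "\<not> d \<le> 0"
    then obtain e where e: "e > 0" "\<And>h. 0 < h \<Longrightarrow> h < e \<Longrightarrow> f' 0 < f' (0 + h)"
      using DERIV_pos_inc_right[OF f'] by auto
    define h where "h = min e \<delta> / 2"
    have h: "0 < h" "h < e" "h < \<delta>" using e max by (auto simp: h_def)
    obtain z where z: "0 < z" "z < h" "f h - f 0 = (h - 0) * f' z"
      using MVT2[OF h(1), of f f'] f by blast
    have "f' z > 0" using e(2)[of z] z h 0 by simp
    then have "f h > f 0" using z h by (metis diff_gt_0_iff_gt diff_zero mult_pos_pos)
    then show False using max(2)[of h] h by simp
  qed
qed

lemma tdist_curve_tendsto:
  assumes c: "\<And>t. c t \<in> her_prod ns" "c 0 = p" and d: "curve_deriv ns c 0 \<xi>"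
  shows "((\<lambda>t. tdist p (c t)) \<longlongrightarrow> 0) (at 0)"
proof -
  have p: "p \<in> her_prod ns" using c by metis
  have t: "tdist p (c t) = sqrt (\<Sum>j<length ns. \<Sum>i<ns ! j. \<Sum>k<ns ! j.
      (cmod ((p ! j) $$ (i, k) - (c t ! j) $$ (i, k)))\<^sup>2)" for t
  proof -
    have D: "tadd p (tscale (- 1) (c t)) \<in> her_prod ns" by (intro her_prod_tadd her_prod_tscale p c)
    show ?thesis unfolding tdist_def Let_def tinner_self[OF D]
      using tadd_tscale_index[OF p c(1)[of t], of _ _ _ "- 1"] by simp
  qed
  have "((\<lambda>t. (c t ! j) $$ (i, k)) \<longlongrightarrow> (p ! j) $$ (i, k)) (at 0)"
    if "j < length ns" "i < ns ! j" "k < ns ! j" for j i k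
  proof -
    have "((\<lambda>t. (c t ! j) $$ (i, k)) has_vector_derivative (\<xi> ! j) $$ (i, k)) (at 0)"
      using d that by (simp add: curve_deriv_def)
    then have "isCont (\<lambda>t. (c t ! j) $$ (i, k)) 0" by (rule has_vector_derivative_continuous)
    then show ?thesis using c(2) by (simp add: isCont_def)
  qed
  then have "((\<lambda>t. sqrt (\<Sum>j<length ns. \<Sum>i<ns ! j. \<Sum>k<ns ! j.
      (cmod ((p ! j) $$ (i, k) - (c t ! j) $$ (i, k)))\<^sup>2)) \<longlongrightarrow>
      sqrt (\<Sum>j<length ns. \<Sum>i<ns ! j. \<Sum>k<ns ! j. (cmod ((p ! j) $$ (i, k) - (p ! j) $$ (i, k)))\<^sup>2)) (at 0)"
    by (intro tendsto_intros) auto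
  then show ?thesis unfolding t by simp
qed

text \<open>
  A curve with a velocity at \<open>0\<close> is continuous there, so it stays near \<open>p\<close> for small times.
\<close>

lemma extremum_along_curve:
  fixes f :: "tuple \<Rightarrow> real"
  assumes ext: "e > 0" "\<And>q. q \<in> M \<Longrightarrow> tdist p q < e \<Longrightarrow> s * f q \<le> s * f p"
    and M: "M \<subseteq> her_prod ns" and c: "curve_through ns M p \<xi> c"
  shows "\<exists>\<delta>>0. \<forall>t. \<bar>t\<bar> < \<delta> \<longrightarrow> s * f (c t) \<le> s * f (c 0)"
proof -
  have cM: "c t \<in> M" for t by (rule curve_through_in[OF c])
  have c0: "c 0 = p" "curve_deriv ns c 0 \<xi>" using c by (auto simp: curve_through_def)
  have "\<forall>\<^sub>F t in at 0. tdist p (c t) < e"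
    using order_tendstoD(2)[OF tdist_curve_tendsto[OF subsetD[OF M cM] c0] ext(1)] .
  then obtain \<delta> where \<delta>: "\<delta> > 0" "\<And>t. t \<noteq> 0 \<Longrightarrow> \<bar>t\<bar> < \<delta> \<Longrightarrow> tdist p (c t) < e"
    unfolding eventually_at by (auto simp: dist_real_def)
  have "s * f (c t) \<le> s * f (c 0)" if "\<bar>t\<bar> < \<delta>" for t
    using ext(2)[OF cM[of t]] \<delta>(2)[of t] that c0 by (cases "t = 0") auto
  then show ?thesis using \<delta>(1) by blast
qed

text \<open>
  The factor \<open>s\<close>, which is \<open>1\<close> or \<open>- 1\<close> in the application, treats maxima and minima together. Along
  an integral curve \<open>c\<close> of \<open>tad \<Omega>\<close> the function \<open>q \<mapsto> rayleigh_diff A q (tad \<Omega> q)\<close> is exactly the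
  derivative of \<open>rayleigh A\<close>, so its own derivative is a second derivative of \<open>rayleigh A\<close> along
  \<open>c\<close> and has the sign prescribed by the extremum.
\<close>

lemma rayleigh_diff_critical:
  fixes s :: real
  assumes A: "A \<in> carrier_mat (prod_list ns) (prod_list ns)" and p: "p \<in> Gr_prod ms ns"
    and s: "s \<noteq> 0"
    and ext: "e > 0" "\<And>q. q \<in> Gr_prod ms ns \<Longrightarrow> tdist p q < e \<Longrightarrow> s * rayleigh A q \<le> s * rayleigh A p"
    and \<Omega>: "\<Omega> \<in> skew_prod ns"
  shows "rayleigh_diff A p (tad \<Omega> p) = 0"
    and "s * tangent_deriv ns (Gr_prod ms ns) (\<lambda>q. rayleigh_diff A q (tad \<Omega> q)) p (tad \<Omega> p) \<le> 0"
proof -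
  let ?M = "Gr_prod ms ns" and ?h = "\<lambda>q. rayleigh_diff A q (tad \<Omega> q)"
  obtain c where c: "curve_through ns ?M p (tad \<Omega> p) c" "\<And>t. curve_deriv ns c t (tad \<Omega> (c t))"
    using Gr_curve[OF p \<Omega>] by blast
  have cH: "c t \<in> her_prod ns" for t using curve_through_in[OF c(1)] Gr_prod_her_prod by blast
  obtain f where f: "polyfun ns f" "\<And>X. X \<in> her_prod ns \<Longrightarrow> ?h X = Re (f X)"
    using polyfun_rayleigh_diff[OF A tad_skew_her[OF \<Omega>] polyfun_tad_const[OF \<Omega>]] by blast
  have 1: "((\<lambda>t. s * rayleigh A (c t)) has_real_derivative s * ?h (c t)) (at t)" for t
    by (intro DERIV_cmult rayleigh_derivative[OF A cH c(2)])
  have 2: "((\<lambda>t. s * ?h (c t)) has_real_derivative s * tangent_deriv ns ?M ?h p (tad \<Omega> p)) (at 0)"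
    using f Gr_prod_her_prod by (intro DERIV_cmult tangent_deriv_polyfun[OF f(1) Gr_prod_her_prod _ c(1)]) auto
  obtain \<delta> where \<delta>: "\<delta> > 0" "\<And>t. \<bar>t\<bar> < \<delta> \<Longrightarrow> s * rayleigh A (c t) \<le> s * rayleigh A (c 0)"
    using extremum_along_curve[where f = "rayleigh A" and s = s, OF ext Gr_prod_her_prod c(1)] by blast
  note T = second_derivative_test[OF 1 2 \<delta>]
  show "?h p = 0" using T(1) s c(1) by (simp add: curve_through_def)
  show "s * tangent_deriv ns ?M ?h p (tad \<Omega> p) \<le> 0" by (rule T(2))
qed

lemma critical_tangent:
  assumes p: "p \<in> Gr_prod ms ns"
    and crit: "\<And>\<Omega>. \<Omega> \<in> skew_prod ns \<Longrightarrow> rayleigh_diff A p (tad \<Omega> p) = 0"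
    and V: "V \<in> Gr_tangent ns p"
  shows "rayleigh_diff A p V = 0"
proof -
  have "tad V p \<in> skew_prod ns"
    using V p Gr_prod_her_prod by (intro tad_her_her) (auto simp: Gr_tangent_def)
  from crit[OF this] show ?thesis unfolding tad_tad_tangent[OF p V] .
qed

text \<open>
  Metric compatibility applied to the gradient and a Killing field: the term with the covariant
  derivative of the Killing field disappears because the gradient vanishes at a critical point. What
  remains contains no connection.
\<close>

lemma hessian_eq:
  assumes A: "A \<in> carrier_mat (prod_list ns) (prod_list ns)" and p: "p \<in> Gr_prod ms ns"
    and crit: "\<And>\<Omega>. \<Omega> \<in> skew_prod ns \<Longrightarrow> rayleigh_diff A p (tad \<Omega> p) = 0"
    and lc: "levi_civita ns (Gr_prod ms ns) nabla"
    and \<Omega>: "\<Omega> \<in> skew_prod ns" and \<xi>: "\<xi> \<in> Gr_tangent ns p"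
  shows "tinner (rhess ns (Gr_prod ms ns) nabla (rayleigh A) p \<xi>) (tad \<Omega> p) =
    tangent_deriv ns (Gr_prod ms ns) (\<lambda>q. rayleigh_diff A q (tad \<Omega> q)) p \<xi>"
proof -
  let ?M = "Gr_prod ms ns" let ?Y = "rgrad ns ?M (rayleigh A)"
  have \<xi>': "\<xi> \<in> tangent_space ns ?M p" using \<xi> tangent_space_Gr[OF p] by simp
  note Y = rgrad_vector_field[OF A, of ms] and Z = tad_vector_field[OF \<Omega>, of ms]
  have pH: "p \<in> her_prod ns" using p Gr_prod_her_prod by blast
  have "nabla p \<xi> (tad \<Omega>) \<in> tangent_space ns ?M p"
    using lc p \<xi>' Z unfolding levi_civita_def affine_connection_def by blast
  then have N: "nabla p \<xi> (tad \<Omega>) \<in> her_prod ns" using tangent_space_Gr[OF p] by (simp add: Gr_tangent_def)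
  have "tinner (?Y p) (nabla p \<xi> (tad \<Omega>)) = 0"
    unfolding rgrad_rayleigh[OF A p] tinner_gradient[OF A pH N]
    by (intro crit tad_her_her N pH)
  moreover have "tangent_deriv ns ?M (\<lambda>q. tinner (?Y q) (tad \<Omega> q)) p \<xi> =
      tinner (nabla p \<xi> ?Y) (tad \<Omega> p) + tinner (?Y p) (nabla p \<xi> (tad \<Omega>))"
    using lc p \<xi>' Y Z unfolding levi_civita_def metric_compatible_def by blast
  moreover have "tangent_deriv ns ?M (\<lambda>q. tinner (?Y q) (tad \<Omega> q)) p \<xi> =
      tangent_deriv ns ?M (\<lambda>q. rayleigh_diff A q (tad \<Omega> q)) p \<xi>"
    using rgrad_rayleigh[OF A] tinner_gradient_tangent[OF A] tad_Gr_tangent[OF _ \<Omega>]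
    by (intro tangent_deriv_cong) simp
  ultimately show ?thesis by (simp add: rhess_def)
qed

text \<open>
  By vanishing torsion, the two mixed derivatives differ by the derivative of the Rayleigh-quotient
  in tangent directions, and this is zero at a critical point.
\<close>

lemma hessian_symmetric:
  assumes A: "A \<in> carrier_mat (prod_list ns) (prod_list ns)" and p: "p \<in> Gr_prod ms ns"
    and crit: "\<And>\<Omega>. \<Omega> \<in> skew_prod ns \<Longrightarrow> rayleigh_diff A p (tad \<Omega> p) = 0"
    and lc: "levi_civita ns (Gr_prod ms ns) nabla"
    and \<xi>: "\<xi> \<in> Gr_tangent ns p" and \<eta>: "\<eta> \<in> Gr_tangent ns p"
  shows "tinner (rhess ns (Gr_prod ms ns) nabla (rayleigh A) p \<xi>) \<eta> =
    tinner (rhess ns (Gr_prod ms ns) nabla (rayleigh A) p \<eta>) \<xi>"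
proof -
  let ?M = "Gr_prod ms ns" let ?f = "rayleigh A"
  \<comment> \<open>Killing fields extending \<open>\<xi>\<close> and \<open>\<eta>\<close>.\<close>
  let ?X = "tad (tad \<xi> p)" and ?Y = "tad (tad \<eta> p)"
  have pH: "p \<in> her_prod ns" using p Gr_prod_her_prod by blast
  have \<Omega>: "tad \<xi> p \<in> skew_prod ns" "tad \<eta> p \<in> skew_prod ns"
    using \<xi> \<eta> pH by (auto intro!: tad_her_her simp: Gr_tangent_def)
  note v = tad_vector_field[OF \<Omega>(1), of ms] tad_vector_field[OF \<Omega>(2), of ms]
  note at_p = tad_tad_tangent[OF p \<xi>] tad_tad_tangent[OF p \<eta>]
  have tg: "\<xi> \<in> tangent_space ns ?M p" "\<eta> \<in> tangent_space ns ?M p"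
    using \<xi> \<eta> tangent_space_Gr[OF p] by auto
  have N: "nabla p \<xi> ?Y \<in> tangent_space ns ?M p" "nabla p \<eta> ?X \<in> tangent_space ns ?M p"
    using lc p tg v unfolding levi_civita_def affine_connection_def by blast+
  have 0: "tangent_deriv ns ?M ?f p Z = 0" if "Z \<in> tangent_space ns ?M p" for Z
    using tangent_deriv_rayleigh[OF A Gr_prod_her_prod that] critical_tangent[OF p crit] that
      tangent_space_Gr[OF p] by simp
  have r: "tangent_deriv ns ?M (\<lambda>q. tangent_deriv ns ?M ?f q (tad \<Omega> q)) p Z =
      tangent_deriv ns ?M (\<lambda>q. rayleigh_diff A q (tad \<Omega> q)) p Z" if "\<Omega> \<in> skew_prod ns" for \<Omega> Z
    using tangent_deriv_rayleigh[OF A Gr_prod_her_prod] tad_Gr_tangent[OF _ that] tangent_space_Gr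
    by (intro tangent_deriv_cong) simp
  have "tangent_deriv ns ?M ?f p (nabla p (?X p) ?Y) - tangent_deriv ns ?M ?f p (nabla p (?Y p) ?X)
      = tangent_deriv ns ?M (\<lambda>q. tangent_deriv ns ?M ?f q (?Y q)) p (?X p)
        - tangent_deriv ns ?M (\<lambda>q. tangent_deriv ns ?M ?f q (?X q)) p (?Y p)"
    using lc p v smooth_fun_rayleigh[OF A, of ms] unfolding levi_civita_def torsion_free_def by blast
  then have "tangent_deriv ns ?M (\<lambda>q. rayleigh_diff A q (?Y q)) p \<xi> =
      tangent_deriv ns ?M (\<lambda>q. rayleigh_diff A q (?X q)) p \<eta>"
    unfolding at_p 0[OF N(1)] 0[OF N(2)] r[OF \<Omega>(1)] r[OF \<Omega>(2)] by simp
  then show ?thesis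
    using hessian_eq[OF A p crit lc \<Omega>(2) \<xi>] hessian_eq[OF A p crit lc \<Omega>(1) \<eta>] unfolding at_p by simp
qed

lemma quadratic_nonpos_imp_linear_0:
  fixes a b :: real
  assumes "\<And>s. 2 * s * a + s\<^sup>2 * b \<le> 0"
  shows "a = 0"
proof (rule ccontr)
  assume a: "a \<noteq> 0"
  \<comment> \<open>Small enough that the linear term dominates: \<open>\<bar>b\<bar> < 2 (\<bar>b\<bar> + 1)\<close>.\<close>
  let ?s = "a / (\<bar>b\<bar> + 1)"
  have pos: "\<bar>b\<bar> + 1 > 0" by simp
  have "2 * r * (r * d) + r\<^sup>2 * b = r\<^sup>2 * (2 * d + b)" for r d :: real
    by (simp add: power2_eq_square algebra_simps)
  from this[of ?s "\<bar>b\<bar> + 1"]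
  have "2 * ?s * a + ?s\<^sup>2 * b = (a / (\<bar>b\<bar> + 1))\<^sup>2 * (2 * (\<bar>b\<bar> + 1) + b)"
    using pos by simp
  moreover have "(a / (\<bar>b\<bar> + 1))\<^sup>2 * (2 * (\<bar>b\<bar> + 1) + b) > 0"
    using a pos by (intro mult_pos_pos) auto
  ultimately show False using assms[of ?s] by simp
qed

text \<open>
  A symmetric semidefinite form has its isotropic vectors in the kernel: with \<open>\<xi>\<close> isotropic and \<open>\<eta> = H \<xi>\<close>, the values of
  the form on \<open>\<xi> + r \<eta>\<close> are \<open>2 r \<langle>\<eta>, \<eta>\<rangle> + r\<^sup>2 \<langle>H \<eta>, \<eta>\<rangle>\<close>, and they keep one sign for all real \<open>r\<close>
  only if \<open>\<eta> = 0\<close>. The tuple \<open>tadd (tscale 0 \<xi>) (tscale 0 \<xi>)\<close> is the zero vector, written so that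
  linearity of the connection applies to it literally.
\<close>

lemma hessian_kernel:
  fixes s :: real
  assumes A: "A \<in> carrier_mat (prod_list ns) (prod_list ns)" and p: "p \<in> Gr_prod ms ns"
    and s: "s \<noteq> 0"
    and ext: "e > 0" "\<And>q. q \<in> Gr_prod ms ns \<Longrightarrow> tdist p q < e \<Longrightarrow> s * rayleigh A q \<le> s * rayleigh A p"
    and lc: "levi_civita ns (Gr_prod ms ns) nabla"
    and \<xi>: "\<xi> \<in> Gr_tangent ns p"
    and iso: "tinner (rhess ns (Gr_prod ms ns) nabla (rayleigh A) p \<xi>) \<xi> = 0"
  shows "rhess ns (Gr_prod ms ns) nabla (rayleigh A) p \<xi> =
    rhess ns (Gr_prod ms ns) nabla (rayleigh A) p (tadd (tscale 0 \<xi>) (tscale 0 \<xi>))"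
proof -
  let ?M = "Gr_prod ms ns" let ?H = "rhess ns ?M nabla (rayleigh A) p"
  let ?T = "Gr_tangent ns p"
  have TH: "V \<in> ?T \<Longrightarrow> V \<in> her_prod ns" for V by (simp add: Gr_tangent_def)
  have pH: "p \<in> her_prod ns" using p Gr_prod_her_prod by blast
  note crit = rayleigh_diff_critical(1)[OF A p s ext]
  note Y = rgrad_vector_field[OF A, of ms]
  have HT: "?H V \<in> ?T" if "V \<in> ?T" for V
    using lc p Y that tangent_space_Gr[OF p] unfolding rhess_def levi_civita_def affine_connection_def by blast
  have lin: "?H (tadd (tscale a V) (tscale b W)) = tadd (tscale a (?H V)) (tscale b (?H W))"
    if "V \<in> ?T" "W \<in> ?T" for V W a b
  proof -
    have "V \<in> tangent_space ns ?M p" "W \<in> tangent_space ns ?M p" using that tangent_space_Gr[OF p] by auto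
    then show ?thesis
      using lc p Y unfolding rhess_def levi_civita_def affine_connection_def by blast
  qed
  have sgn: "s * tinner (?H V) V \<le> 0" if V: "V \<in> ?T" for V
  proof -
    have \<Omega>: "tad V p \<in> skew_prod ns" by (intro tad_her_her TH V pH)
    show ?thesis
      using rayleigh_diff_critical(2)[OF A p s ext \<Omega>] hessian_eq[OF A p crit lc \<Omega> V]
      unfolding tad_tad_tangent[OF p V] by simp
  qed
  define \<eta> where "\<eta> = ?H \<xi>"
  have \<eta>: "\<eta> \<in> ?T" unfolding \<eta>_def by (rule HT[OF \<xi>])
  note h = TH[OF \<xi>] TH[OF \<eta>] TH[OF HT[OF \<eta>]]
  have "2 * r * (s * tinner \<eta> \<eta>) + r\<^sup>2 * (s * tinner (?H \<eta>) \<eta>) \<le> 0" for r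
  proof -
    let ?V = "tadd (tscale 1 \<xi>) (tscale r \<eta>)"
    have V: "?V \<in> ?T" by (rule Gr_tangent_linear[OF p \<xi> \<eta>])
    have "tinner (?H ?V) ?V = tinner \<eta> \<xi> + r * tinner \<eta> \<eta> + r * (tinner (?H \<eta>) \<xi> + r * tinner (?H \<eta>) \<eta>)"
      unfolding lin[OF \<xi> \<eta>] \<eta>_def[symmetric] tinner_linear_left[OF h(2,3) TH[OF V]]
        tinner_linear_right[OF h(1,2,2)] tinner_linear_right[OF h(1,2,3)] by simp
    also have "tinner (?H \<eta>) \<xi> = tinner \<eta> \<eta>"
      using hessian_symmetric[OF A p crit lc \<xi> \<eta>] unfolding \<eta>_def by simp
    also have "tinner \<eta> \<xi> = 0" using iso unfolding \<eta>_def .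
    finally have "s * (2 * r * tinner \<eta> \<eta> + r * r * tinner (?H \<eta>) \<eta>) \<le> 0"
      using sgn[OF V] by (simp add: algebra_simps)
    then show ?thesis by (simp add: algebra_simps power2_eq_square)
  qed
  then have "s * tinner \<eta> \<eta> = 0" by (rule quadratic_nonpos_imp_linear_0)
  then have \<eta>0: "tinner \<eta> \<eta> = 0" using s by simp
  have "\<eta> = tadd (tscale 0 \<eta>) (tscale 0 \<eta>)"
  proof (rule nth_equalityI)
    show "length \<eta> = length (tadd (tscale 0 \<eta>) (tscale 0 \<eta>))" by simp
    fix j assume "j < length \<eta>"
    then have j: "j < length ns" using h by (simp add: her_prod_length)
    show "\<eta> ! j = tadd (tscale 0 \<eta>) (tscale 0 \<eta>) ! j"
      using tinner_self_eq_0[OF h(2) \<eta>0 j] j h by (auto simp: her_prod_length intro!: eq_matI)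
  qed
  then show ?thesis unfolding lin[OF \<xi> \<xi>] \<eta>_def .
qed

section \<open>An isotropic direction from a common eigenvalue\<close>

lemma minus_four_block_mat:
  fixes A1 :: "complex mat"
  assumes "A1 \<in> carrier_mat n1 m1" "B1 \<in> carrier_mat n1 m2" "C1 \<in> carrier_mat n2 m1" "D1 \<in> carrier_mat n2 m2"
    "A2 \<in> carrier_mat n1 m1" "B2 \<in> carrier_mat n1 m2" "C2 \<in> carrier_mat n2 m1" "D2 \<in> carrier_mat n2 m2"
  shows "four_block_mat A1 B1 C1 D1 - four_block_mat A2 B2 C2 D2 =
    four_block_mat (A1 - A2) (B1 - B2) (C1 - C2) (D1 - D2)"
  using assms by (intro eq_matI) auto

lemma mtrace_four_block_mat:
  assumes "A \<in> carrier_mat m m" "D \<in> carrier_mat k k"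
  shows "mtrace (four_block_mat A B C D) = mtrace A + mtrace D"
proof -
  have split: "(\<Sum>i<m + k. f i) = (\<Sum>i<m. f i) + (\<Sum>i<k. f (m + i))" for f :: "nat \<Rightarrow> complex"
    by (induction k) (auto simp: add.assoc)
  show ?thesis using assms unfolding mtrace_def by (simp add: split)
qed

text \<open>
  \<open>E\<close> is the standard projection and \<open>Y\<close> the tangent vector at \<open>E\<close> with upper right block \<open>X\<close>. The
  generator belonging to \<open>Y\<close> is \<open>ad Y E\<close>, and \<open>ad (ad Y E) Y\<close> is the acceleration at \<open>E\<close> of its orbit.
\<close>

lemma off_diagonal_block:
  fixes X :: "complex mat"
  assumes X: "X \<in> carrier_mat m k"
  defines "Y \<equiv> four_block_mat (0\<^sub>m m m) X (mat_adjoint X) (0\<^sub>m k k)"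
    and "E \<equiv> four_block_mat (1\<^sub>m m) (0\<^sub>m m k) (0\<^sub>m k m) (0\<^sub>m k k)"
  shows "Y \<in> her (m + k)" "Y = E * Y + Y * E"
    and "ad (ad Y E) Y = four_block_mat (- (X * mat_adjoint X) - X * mat_adjoint X) (0\<^sub>m m k) (0\<^sub>m k m)
      (mat_adjoint X * X + mat_adjoint X * X)"
proof -
  let ?X' = "mat_adjoint X"
  have X': "?X' \<in> carrier_mat k m" using X by simp
  note cs = X X' one_carrier_mat[of m] zero_carrier_mat[of m k] zero_carrier_mat[of k m]
    zero_carrier_mat[of k k] zero_carrier_mat[of m m]
  show "Y \<in> her (m + k)"
    unfolding her_iff_entries Y_def using X by (auto simp: four_block_mat_def Let_def)
  have YE: "Y * E = four_block_mat (0\<^sub>m m m) (0\<^sub>m m k) ?X' (0\<^sub>m k k)"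
    unfolding Y_def E_def using X X'
    by (subst mult_four_block_mat[of _ m m _ k _ k _ _ m _ k]) auto
  have EY: "E * Y = four_block_mat (0\<^sub>m m m) X (0\<^sub>m k m) (0\<^sub>m k k)"
    unfolding Y_def E_def using X X'
    by (subst mult_four_block_mat[of _ m m _ k _ k _ _ m _ k]) auto
  show "Y = E * Y + Y * E"
    unfolding YE EY using X X' unfolding Y_def
    by (subst add_four_block_mat[of _ m m _ k _ k]) auto
  have c: "ad Y E = four_block_mat (0\<^sub>m m m) (- X) ?X' (0\<^sub>m k k)"
    unfolding ad_def YE EY using X X'
    by (subst minus_four_block_mat[of _ m m _ k _ k]) (auto intro!: cong_four_block_mat eq_matI)
  have 1: "ad Y E * Y = four_block_mat (- (X * ?X')) (0\<^sub>m m k) (0\<^sub>m k m) (?X' * X)"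
    unfolding c unfolding Y_def using X X'
    by (subst mult_four_block_mat[of _ m m _ k _ k _ _ m _ k]) auto
  have 2: "Y * ad Y E = four_block_mat (X * ?X') (0\<^sub>m m k) (0\<^sub>m k m) (- (?X' * X))"
    unfolding c unfolding Y_def using X X'
    by (subst mult_four_block_mat[of _ m m _ k _ k _ _ m _ k]) auto
  show "ad (ad Y E) Y = four_block_mat (- (X * mat_adjoint X) - X * mat_adjoint X) (0\<^sub>m m k) (0\<^sub>m k m)
      (mat_adjoint X * X + mat_adjoint X * X)"
    unfolding ad_def[of "ad Y E"] 1 2 using X X'
    by (subst minus_four_block_mat[of _ m m _ k _ k]) (auto intro!: cong_four_block_mat eq_matI)
qed

text \<open>
  For eigenvectors \<open>x\<close> of \<open>S\<close> and \<open>y\<close> of \<open>T\<close> with the common eigenvalue \<open>l\<close>, take the block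
  \<open>X = x y\<^sup>*\<close>. Then \<open>S X = l X\<close> and \<open>T X\<^sup>* = l X\<^sup>*\<close>, so the two diagonal blocks of the acceleration
  contribute \<open>- 2 l tr (X X\<^sup>*)\<close> and \<open>2 l tr (X\<^sup>* X)\<close>, which cancel.
\<close>

lemma isotropic_off_diagonal:
  fixes S T :: "complex mat"
  assumes S: "S \<in> carrier_mat m m" and T: "T \<in> carrier_mat k k"
    and R: "R1 \<in> carrier_mat m k" "R2 \<in> carrier_mat k m"
    and l: "l \<in> spectrum S" "l \<in> spectrum T"
  defines "E \<equiv> four_block_mat (1\<^sub>m m) (0\<^sub>m m k) (0\<^sub>m k m) (0\<^sub>m k k)"
  shows "\<exists>Y\<in>her (m + k). Y \<noteq> 0\<^sub>m (m + k) (m + k) \<and> Y = E * Y + Y * E \<and>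
    mtrace (four_block_mat S R1 R2 T * ad (ad Y E) Y) = 0"
proof -
  obtain x where x: "x \<in> carrier_vec m" "x \<noteq> 0\<^sub>v m" "S *\<^sub>v x = l \<cdot>\<^sub>v x"
    using l(1) S by (auto simp: spectrum_def eigenvalue_def eigenvector_def)
  obtain y where y: "y \<in> carrier_vec k" "y \<noteq> 0\<^sub>v k" "T *\<^sub>v y = l \<cdot>\<^sub>v y"
    using l(2) T by (auto simp: spectrum_def eigenvalue_def eigenvector_def)
  define X where "X = mat m k (\<lambda>(a, b). x $ a * cnj (y $ b))"
  have X: "X \<in> carrier_mat m k" by (simp add: X_def)
  have X': "mat_adjoint X \<in> carrier_mat k m" using X by simp
  have SX: "S * X = l \<cdot>\<^sub>m X"
  proof (rule eq_matI)
    fix a b assume "a < dim_row (l \<cdot>\<^sub>m X)" "b < dim_col (l \<cdot>\<^sub>m X)"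
    then have ab: "a < m" "b < k" using X by auto
    have "(S * X) $$ (a, b) = (S *\<^sub>v x) $ a * cnj (y $ b)"
      using ab S x(1) X by (simp add: scalar_prod_def X_def sum_distrib_right mult.assoc)
    then show "(S * X) $$ (a, b) = (l \<cdot>\<^sub>m X) $$ (a, b)"
      using ab x by (simp add: X_def)
  qed (use S X in auto)
  have TX: "T * mat_adjoint X = l \<cdot>\<^sub>m mat_adjoint X"
  proof (rule eq_matI)
    fix b a assume "b < dim_row (l \<cdot>\<^sub>m mat_adjoint X)" "a < dim_col (l \<cdot>\<^sub>m mat_adjoint X)"
    then have ab: "a < m" "b < k" using X by auto
    have e: "mat_adjoint X $$ (c, a) = cnj (x $ a) * y $ c" if "c < k" for c
      using that ab X by (simp add: X_def mult.commute)
    have "(T * mat_adjoint X) $$ (b, a) = (\<Sum>c\<in>{0..<k}. T $$ (b, c) * mat_adjoint X $$ (c, a))"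
      using ab T X by (auto simp: scalar_prod_def)
    also have "\<dots> = cnj (x $ a) * (T *\<^sub>v y) $ b"
      using ab T y(1) by (simp add: scalar_prod_def e sum_distrib_left mult_ac)
    finally show "(T * mat_adjoint X) $$ (b, a) = (l \<cdot>\<^sub>m mat_adjoint X) $$ (b, a)"
      using ab y X e by simp
  qed (use T X in auto)
  obtain a where a: "a < m" "x $ a \<noteq> 0" using x(1,2) by (metis eq_vecI carrier_vecD index_zero_vec)
  obtain b where b: "b < k" "y $ b \<noteq> 0" using y(1,2) by (metis eq_vecI carrier_vecD index_zero_vec)
  define Y where "Y = four_block_mat (0\<^sub>m m m) X (mat_adjoint X) (0\<^sub>m k k)"
  note off = off_diagonal_block[OF X, folded Y_def E_def]
  have "Y $$ (a, m + b) = X $$ (a, b)" using a b X by (simp add: Y_def)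
  also have "\<dots> \<noteq> 0" using a b by (simp add: X_def)
  finally have "Y \<noteq> 0\<^sub>m (m + k) (m + k)" using a b by auto
  moreover have "mtrace (four_block_mat S R1 R2 T * ad (ad Y E) Y) = 0"
  proof -
    define U where "U = X * mat_adjoint X"
    define U' where "U' = mat_adjoint X * X"
    have U: "U \<in> carrier_mat m m" "U' \<in> carrier_mat k k" using X X' by (auto simp: U_def U'_def)
    have tr: "mtrace U = mtrace U'" unfolding U_def U'_def by (rule mtrace_comm[OF X X'])
    have SU: "S * U = l \<cdot>\<^sub>m U" and TU: "T * U' = l \<cdot>\<^sub>m U'"
      unfolding U_def U'_def assoc_mult_mat[OF S X X', symmetric] assoc_mult_mat[OF T X' X, symmetric]
        SX TX by (rule mult_smult_assoc_mat[OF X X'], rule mult_smult_assoc_mat[OF X' X])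
    have "four_block_mat S R1 R2 T * ad (ad Y E) Y =
        four_block_mat (S * (- U - U)) (R1 * (U' + U')) (R2 * (- U - U)) (T * (U' + U'))"
      unfolding off(3) U_def[symmetric] U'_def[symmetric] using S T R U
      by (subst mult_four_block_mat[of _ m m _ k _ k _ _ m _ k]) (auto intro!: cong_four_block_mat)
    then have "mtrace (four_block_mat S R1 R2 T * ad (ad Y E) Y) =
        mtrace (S * (- U - U)) + mtrace (T * (U' + U'))"
      using mtrace_four_block_mat[OF mult_carrier_mat[OF S minus_carrier_mat[OF U(1)]]
          mult_carrier_mat[OF T add_carrier_mat[OF U(2)]]] by simp
    also have "S * (- U - U) = - (l \<cdot>\<^sub>m U) - l \<cdot>\<^sub>m U"
      using S U SU by (simp add: mult_minus_distrib_mat[of _ m m _ m])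
    also have "mtrace \<dots> = - 2 * l * mtrace U"
      using U by (auto simp: mtrace_def sum_distrib_left sum_negf[symmetric] algebra_simps
          simp flip: sum_subtractf intro!: sum.cong)
    also have "T * (U' + U') = l \<cdot>\<^sub>m U' + l \<cdot>\<^sub>m U'"
      using T U TU by (simp add: mult_add_distrib_mat[of _ k k _ k])
    also have "mtrace \<dots> = 2 * l * mtrace U'"
      using U by (simp add: mtrace_add[of _ k] mtrace_smult[of _ k])
    finally show ?thesis using tr by simp
  qed
  ultimately show ?thesis using off(1,2) by blast
qed

text \<open>
  Conjugation by a unitary matrix is multiplicative and additive, hence preserves commutators.
\<close>

lemma unitary_conj:
  assumes \<Theta>: "\<Theta> \<in> carrier_mat n n" "mat_adjoint \<Theta> * \<Theta> = 1\<^sub>m n"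
    and Y: "Y \<in> carrier_mat n n" "Z \<in> carrier_mat n n"
  shows "(\<Theta> * Y * mat_adjoint \<Theta>) * (\<Theta> * Z * mat_adjoint \<Theta>) = \<Theta> * (Y * Z) * mat_adjoint \<Theta>"
    and "ad (\<Theta> * Y * mat_adjoint \<Theta>) (\<Theta> * Z * mat_adjoint \<Theta>) = \<Theta> * ad Y Z * mat_adjoint \<Theta>"
proof -
  let ?U = "mat_adjoint \<Theta>"
  have U: "?U \<in> carrier_mat n n" using \<Theta> by simp
  have UU: "?U * (\<Theta> * X) = X" if "X \<in> carrier_mat n n" for X
    using assoc_mult_mat[OF U \<Theta>(1) that] \<Theta>(2) that by simp
  have 1: "(\<Theta> * Y * ?U) * (\<Theta> * Z * ?U) = \<Theta> * (Y * Z) * ?U"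
    if Y: "Y \<in> carrier_mat n n" "Z \<in> carrier_mat n n" for Y Z
    using \<Theta>(1) U Y UU by (simp add: assoc_mult_mat[of _ n n _ n _ n])
  show "(\<Theta> * Y * ?U) * (\<Theta> * Z * ?U) = \<Theta> * (Y * Z) * ?U" by (rule 1[OF Y])
  show "ad (\<Theta> * Y * ?U) (\<Theta> * Z * ?U) = \<Theta> * ad Y Z * ?U"
    unfolding ad_def 1[OF Y] 1[OF Y(2,1)] using \<Theta>(1) U Y
    by (simp add: mult_minus_distrib_mat[of _ n n _ n] minus_mult_distrib_mat[of _ n n _ _ n])
qed

text \<open>
  The previous construction, carried from the standard projection to \<open>P\<close> by conjugation with \<open>\<Theta>\<close>.
\<close>

lemma isotropic_direction:
  assumes \<Theta>: "\<Theta> \<in> SU n" and mn: "m \<le> n" and P: "P \<in> carrier_mat n n"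
    and std: "mat_adjoint \<Theta> * P * \<Theta> = std_proj m n"
    and B: "B \<in> carrier_mat n n"
    and split: "split_block (mat_adjoint \<Theta> * B * \<Theta>) m m = (S, R1, R2, T)"
    and l: "l \<in> spectrum S" "l \<in> spectrum T"
  shows "\<exists>W\<in>her n. W \<noteq> 0\<^sub>m n n \<and> W = P * W + W * P \<and> mtrace (B * ad (ad W P) W) = 0"
proof -
  let ?U = "mat_adjoint \<Theta>" and ?k = "n - m"
  have \<Theta>c: "\<Theta> \<in> carrier_mat n n" "?U * \<Theta> = 1\<^sub>m n" "\<Theta> * ?U = 1\<^sub>m n" and U: "?U \<in> carrier_mat n n"
    using \<Theta> by (auto simp: SU_def)
  have n: "n = m + ?k" using mn by simp
  define E where "E = std_proj m n"
  have E: "E = four_block_mat (1\<^sub>m m) (0\<^sub>m m ?k) (0\<^sub>m ?k m) (0\<^sub>m ?k ?k)" by (simp add: E_def std_proj_def)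
  have Ec: "E \<in> carrier_mat n n" unfolding E using n by auto
  have "dim_row (?U * B * \<Theta>) = m + ?k" "dim_col (?U * B * \<Theta>) = m + ?k" using \<Theta>c B mn by auto
  note sb = split_block[OF split this]
  obtain Y where Y: "Y \<in> her n" "Y \<noteq> 0\<^sub>m n n" "Y = E * Y + Y * E"
    "mtrace (?U * B * \<Theta> * ad (ad Y E) Y) = 0"
    using isotropic_off_diagonal[OF sb(1,4,2,3) l, folded E sb(5)] n by auto
  have Yc: "Y \<in> carrier_mat n n" using Y(1) by (rule her_carrier)
  define W where "W = \<Theta> * Y * ?U"
  have Wc: "W \<in> carrier_mat n n" unfolding W_def by (intro mult_carrier_mat[of _ n n] \<Theta>c(1) U Yc)
  have ass: "\<Theta> * (?U * X * \<Theta>) * ?U = X" if X: "X \<in> carrier_mat n n" for X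
  proof -
    have "\<Theta> * (?U * X * \<Theta>) * ?U = (\<Theta> * ?U) * X * (\<Theta> * ?U)"
      using \<Theta>c(1) U X by (simp add: assoc_mult_mat[of _ n n _ n _ n] mult_carrier_mat[of _ n n _ n])
    then show ?thesis using X \<Theta>c(3) by simp
  qed
  have PE: "P = \<Theta> * E * ?U" using ass[OF P] unfolding std E_def by simp
  have YW: "?U * W * \<Theta> = Y"
  proof -
    have "?U * W * \<Theta> = (?U * \<Theta>) * Y * (?U * \<Theta>)"
      unfolding W_def using \<Theta>c(1) U Yc
      by (simp add: assoc_mult_mat[of _ n n _ n _ n] mult_carrier_mat[of _ n n _ n])
    then show ?thesis using Yc \<Theta>c(2) by simp
  qed
  have "W \<in> her n"
    using Wc Y(1) \<Theta>c(1) U Yc unfolding her_def W_def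
    by (simp add: mat_adjoint_mult[of _ n n _ n] assoc_mult_mat[of _ n n _ n _ n])
  moreover have "W \<noteq> 0\<^sub>m n n"
  proof
    assume "W = 0\<^sub>m n n"
    then have "Y = 0\<^sub>m n n" using YW \<Theta>c U by simp
    then show False using Y(2) by simp
  qed
  moreover have "W = P * W + W * P"
  proof -
    have c: "E * Y \<in> carrier_mat n n" "Y * E \<in> carrier_mat n n" using Ec Yc by (auto intro: mult_carrier_mat)
    have "P * W + W * P = \<Theta> * (E * Y) * ?U + \<Theta> * (Y * E) * ?U"
      unfolding PE W_def unitary_conj(1)[OF \<Theta>c(1,2) Ec Yc] unitary_conj(1)[OF \<Theta>c(1,2) Yc Ec] ..
    also have "\<dots> = \<Theta> * (E * Y + Y * E) * ?U"
      using c \<Theta>c(1) U by (simp add: mult_add_distrib_mat[of _ n n _ n] add_mult_distrib_mat[of _ n n _ _ n])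
    finally show ?thesis unfolding Y(3)[symmetric] W_def by simp
  qed
  moreover have "mtrace (B * ad (ad W P) W) = 0"
  proof -
    let ?Z = "ad (ad Y E) Y"
    have Z: "?Z \<in> carrier_mat n n" using Yc Ec by simp
    have "ad (ad W P) W = \<Theta> * ?Z * ?U"
      unfolding PE W_def unitary_conj(2)[OF \<Theta>c(1,2) Yc Ec]
        unitary_conj(2)[OF \<Theta>c(1,2) ad_carrier[OF Yc Ec] Yc] ..
    then have "mtrace (B * ad (ad W P) W) = mtrace ((B * \<Theta> * ?Z) * ?U)"
      using B \<Theta>c(1) U Z by (simp add: assoc_mult_mat[of _ n n _ n _ n])
    also have "\<dots> = mtrace (?U * (B * \<Theta> * ?Z))"
      using B \<Theta>c(1) U Z by (intro mtrace_comm[of _ n n]) (auto intro!: mult_carrier_mat)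
    also have "?U * (B * \<Theta> * ?Z) = ?U * B * \<Theta> * ?Z"
      using B \<Theta>c(1) U Z by (simp add: assoc_mult_mat[of _ n n _ n _ n])
    finally show ?thesis using Y(4) by simp
  qed
  ultimately show ?thesis by blast
qed

lemma kron_trace_update_0:
  assumes "A \<in> carrier_mat (prod_list ns) (prod_list ns)" "X \<in> sq_prod ns" "j < length ns"
  shows "kron_trace A (X[j := 0\<^sub>m (ns ! j) (ns ! j)]) = 0"
proof -
  note a = Ahat[OF assms]
  have "kron_trace A (X[j := 0\<^sub>m (ns ! j) (ns ! j)]) = mtrace (Ahat ns A X j * 0\<^sub>m (ns ! j) (ns ! j))"
    by (rule a(2)) simp
  also have "\<dots> = 0" using a(1) by (simp add: mtrace_def)
  finally show ?thesis .
qed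

text \<open>
  For a direction \<open>V\<close> concentrated in slot \<open>j\<close>, the Killing field through \<open>V\<close> changes slot \<open>j\<close> only,
  and so the Rayleigh-quotient enters through its linear dependence on that slot. The second
  derivative is the pairing of \<^const>\<open>Ahat\<close> with the acceleration \<open>ad (ad W (p ! j)) W\<close>.
\<close>

lemma hessian_isotropic:
  assumes A: "A \<in> carrier_mat (prod_list ns) (prod_list ns)" and p: "p \<in> Gr_prod ms ns"
    and j: "j < length ns" and W: "W \<in> her (ns ! j)" "W = p ! j * W + W * p ! j"
    and tr: "mtrace (Ahat ns A p j * ad (ad W (p ! j)) W) = 0"
  defines "V \<equiv> map (\<lambda>l. if l = j then W else 0\<^sub>m (ns ! l) (ns ! l)) [0..<length ns]"
  shows "V \<in> Gr_tangent ns p"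
    and "tangent_deriv ns (Gr_prod ms ns) (\<lambda>q. rayleigh_diff A q (tad (tad V p) q)) p V = 0"
proof -
  have pH: "p \<in> her_prod ns" using p Gr_prod_her_prod by blast
  have lV: "length V = length ns" "length p = length ns" using pH by (simp_all add: V_def her_prod_length)
  have Vl: "V ! l = (if l = j then W else 0\<^sub>m (ns ! l) (ns ! l))" if "l < length ns" for l
    using that by (simp add: V_def)
  have z: "0\<^sub>m n n \<in> her n" for n unfolding her_iff_entries by auto
  have VH: "V \<in> her_prod ns" unfolding her_prod_def using lV Vl W(1) z by auto
  have "V ! l = p ! l * V ! l + V ! l * p ! l" if l: "l < length ns" for l
  proof (cases "l = j")
    case True
    then show ?thesis using Vl[OF l] W(2) by auto
  next
    case False
    then show ?thesis using Vl[OF l] her_prodD(2)[OF pH l] by simp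
  qed
  then show VT: "V \<in> Gr_tangent ns p" using VH by (simp add: Gr_tangent_def)
  let ?\<Omega> = "tad V p"
  have \<Omega>: "?\<Omega> \<in> skew_prod ns" by (intro tad_her_her VH pH)
  have \<Omega>j: "?\<Omega> ! j = ad W (p ! j)" using j lV Vl by simp
  have ad0: "ad (0\<^sub>m n n) X = 0\<^sub>m n n" if "X \<in> carrier_mat n n" for X n
    using that by (simp add: ad_def)
  have \<Omega>l: "tad ?\<Omega> q ! l = 0\<^sub>m (ns ! l) (ns ! l)" if "q \<in> her_prod ns" "l < length ns" "l \<noteq> j" for q l
    using that lV Vl her_prodD(2)[OF pH that(2)] her_prodD(2)[OF that(1,2)]
    by (simp add: ad0 her_prod_length)
  \<comment> \<open>All other slots of the Killing field vanish, so only this term of the differential survives.\<close>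
  define C where "C q = q[j := tad ?\<Omega> q ! j]" for q
  have CH: "C q \<in> her_prod ns" if q: "q \<in> her_prod ns" for q
    using q tad_skew_her[OF \<Omega> q] j by (auto simp: C_def her_prod_def nth_list_update)
  have h: "rayleigh_diff A q (tad ?\<Omega> q) = Re (kron_trace A (C q))" if q: "q \<in> her_prod ns" for q
  proof -
    have "rayleigh_diff A q (tad ?\<Omega> q) =
        (\<Sum>l<length ns. if l = j then Re (kron_trace A (C q)) else 0)"
      unfolding rayleigh_diff_def her_prod_length[OF q]
      using \<Omega>l[OF q] kron_trace_update_0[OF A her_prod_sq_prod[OF q]]
      by (intro sum.cong refl) (auto simp: C_def)
    then show ?thesis using j by simp
  qed
  show "tangent_deriv ns (Gr_prod ms ns) (\<lambda>q. rayleigh_diff A q (tad ?\<Omega> q)) p V = 0"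
  proof (rule tangent_deriv_eqI)
    show "V \<in> tangent_space ns (Gr_prod ms ns) p" using VT tangent_space_Gr[OF p] by simp
    fix c assume c: "curve_through ns (Gr_prod ms ns) p V c"
    have cH: "c t \<in> her_prod ns" for t using curve_through_in[OF c] Gr_prod_her_prod by blast
    have c0: "c 0 = p" "curve_deriv ns c 0 V" using c by (auto simp: curve_through_def)
    let ?V' = "V[j := ad (?\<Omega> ! j) W]"
    have \<Omega>c: "?\<Omega> ! j \<in> carrier_mat (ns ! j) (ns ! j)" by (rule skew_prodD(2)[OF \<Omega> j])
    have V'H: "?V' \<in> her_prod ns"
      using VH ad_skew_her[OF skew_prodD(1)[OF \<Omega> j] W(1)] j by (auto simp: her_prod_def nth_list_update)
    have "curve_deriv ns (\<lambda>t. C (c t)) 0 ?V'"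
      unfolding curve_deriv_def
    proof (intro conjI V'H allI impI)
      fix l i k assume l: "l < length ns" and ik: "i < ns ! l" "k < ns ! l"
      show "((\<lambda>s. (C (c s) ! l) $$ (i, k)) has_vector_derivative (?V' ! l) $$ (i, k)) (at 0)"
      proof (cases "l = j")
        case False
        then show ?thesis using c0(2) l ik lV by (simp add: C_def curve_deriv_def)
      next
        case True
        have 1: "(C (c s) ! l) $$ (i, k) =
            (\<Sum>b<ns ! j. (?\<Omega> ! j) $$ (i, b) * (c s ! j) $$ (b, k) - (c s ! j) $$ (i, b) * (?\<Omega> ! j) $$ (b, k))" for s
        proof -
          have "C (c s) ! l = ad (?\<Omega> ! j) (c s ! j)"
            using True j lV her_prod_length[OF cH[of s]] by (simp add: C_def)
          then show ?thesis using ad_index[OF \<Omega>c her_prodD(2)[OF cH j]] ik True by simp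
        qed
        have 2: "(?V' ! l) $$ (i, k) =
            (\<Sum>b<ns ! j. (?\<Omega> ! j) $$ (i, b) * (V ! j) $$ (b, k) - (V ! j) $$ (i, b) * (?\<Omega> ! j) $$ (b, k))"
        proof -
          have "?V' ! l = ad (?\<Omega> ! j) (V ! j)" using True j lV Vl by simp
          then show ?thesis using ad_index[OF \<Omega>c her_prodD(2)[OF VH j]] ik True by simp
        qed
        show ?thesis unfolding 1 2 using c0(2) j ik True
          by (intro has_vector_derivative_sum has_vector_derivative_diff
              has_vector_derivative_mult_left has_vector_derivative_mult_right)
            (auto simp: curve_deriv_def)
      qed
    qed
    from has_real_derivative_Re[OF kron_trace_derivative[OF A CH[OF cH] this]]
    have "((\<lambda>s. Re (kron_trace A (C (c s)))) has_real_derivative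
        Re (\<Sum>l<length ns. kron_trace A ((C p)[l := ?V' ! l]))) (at 0)" unfolding c0(1) .
    moreover have "kron_trace A ((C p)[l := ?V' ! l]) = 0" if l: "l < length ns" for l
    proof (cases "l = j")
      case False
      then have "?V' ! l = 0\<^sub>m (ns ! l) (ns ! l)" using Vl[OF l] by simp
      then show ?thesis using kron_trace_update_0[OF A her_prod_sq_prod[OF CH[OF pH]] l] by simp
    next
      case True
      have "(C p)[l := ?V' ! l] = p[j := ad (?\<Omega> ! j) W]"
        using True j lV by (simp add: C_def)
      then show ?thesis
        using Ahat(2)[OF A her_prod_sq_prod[OF pH] j ad_carrier[OF \<Omega>c her_carrier[OF W(1)]]] tr \<Omega>j by simp
    qed
    ultimately have "((\<lambda>s. Re (kron_trace A (C (c s)))) has_real_derivative 0) (at 0)" by simp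
    then show "((\<lambda>t. rayleigh_diff A (c t) (tad ?\<Omega> (c t))) has_real_derivative 0) (at 0)"
      unfolding h[OF cH] .
  qed
qed

section \<open>Disjointness of the spectra\<close>

theorem theorem3p10:
  fixes r :: nat and ms ns :: "nat list" and A :: "complex mat" and P :: tuple
    and nabla :: "tuple \<Rightarrow> tuple \<Rightarrow> (tuple \<Rightarrow> tuple) \<Rightarrow> tuple"
  assumes "r \<ge> 1" and "length ms = r" and "length ns = r"
    and "\<forall>j<r. 1 \<le> ms ! j \<and> ms ! j \<le> ns ! j"
    and "A \<in> her (prod_list ns)"
    and "P \<in> Gr_prod ms ns"
    and "local_maximizer (Gr_prod ms ns) (rayleigh A) P \<or>
         local_minimizer (Gr_prod ms ns) (rayleigh A) P"
    and "levi_civita ns (Gr_prod ms ns) nabla"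
    and "nondegenerate_at ns (Gr_prod ms ns) P (rhess ns (Gr_prod ms ns) nabla (rayleigh A) P)"
  shows "\<forall>j<r. \<forall>\<Theta> \<Psi>' \<Psi>'' \<Psi>''' \<Phi>.
           \<Theta> \<in> SU (ns ! j) \<and>
           mat_adjoint \<Theta> * (P ! j) * \<Theta> = std_proj (ms ! j) (ns ! j) \<and>
           split_block (mat_adjoint \<Theta> * Ahat ns A P j * \<Theta>) (ms ! j) (ms ! j) = (\<Psi>', \<Psi>''', \<Phi>, \<Psi>'')
           \<longrightarrow> spectrum \<Psi>' \<inter> spectrum \<Psi>'' = {}"
proof (intro allI impI, elim conjE, rule ccontr)
  fix j \<Theta> \<Psi>' \<Psi>'' \<Psi>''' \<Phi>
  assume j: "j < r" and \<Theta>: "\<Theta> \<in> SU (ns ! j)"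
    and std: "mat_adjoint \<Theta> * (P ! j) * \<Theta> = std_proj (ms ! j) (ns ! j)"
    and split: "split_block (mat_adjoint \<Theta> * Ahat ns A P j * \<Theta>) (ms ! j) (ms ! j) = (\<Psi>', \<Psi>''', \<Phi>, \<Psi>'')"
    and ne: "spectrum \<Psi>' \<inter> spectrum \<Psi>'' \<noteq> {}"
  let ?M = "Gr_prod ms ns" and ?H = "rhess ns (Gr_prod ms ns) nabla (rayleigh A) P"
  note p = assms(6) and lc = assms(8)
  have A: "A \<in> carrier_mat (prod_list ns) (prod_list ns)" using assms(5) by (rule her_carrier)
  have jl: "j < length ns" using j assms(3) by simp
  have pH: "P \<in> her_prod ns" using p Gr_prod_her_prod by blast
  have Pj: "P ! j \<in> carrier_mat (ns ! j) (ns ! j)" by (rule her_prodD(2)[OF pH jl])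
  have mn: "ms ! j \<le> ns ! j" using assms(4) j by blast
  obtain l where l: "l \<in> spectrum \<Psi>'" "l \<in> spectrum \<Psi>''" using ne by blast
  obtain W where W: "W \<in> her (ns ! j)" "W \<noteq> 0\<^sub>m (ns ! j) (ns ! j)" "W = P ! j * W + W * P ! j"
    "mtrace (Ahat ns A P j * ad (ad W (P ! j)) W) = 0"
    using isotropic_direction[OF \<Theta> mn Pj std Ahat(1)[OF A her_prod_sq_prod[OF pH] jl] split l] by blast
  define V where "V = map (\<lambda>l. if l = j then W else 0\<^sub>m (ns ! l) (ns ! l)) [0..<length ns]"
  note iso = hessian_isotropic[OF A p jl W(1,3,4), folded V_def]
  obtain s e :: real where s: "s \<noteq> 0" and e: "e > 0"
    and ext: "\<And>q. q \<in> ?M \<Longrightarrow> tdist P q < e \<Longrightarrow> s * rayleigh A q \<le> s * rayleigh A P"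
    using assms(7)
  proof
    assume "local_maximizer ?M (rayleigh A) P"
    then obtain e where "e > 0" "\<forall>q\<in>?M. tdist P q < e \<longrightarrow> rayleigh A q \<le> rayleigh A P"
      unfolding local_maximizer_def by blast
    then show thesis by (intro that[of 1 e]) auto
  next
    assume "local_minimizer ?M (rayleigh A) P"
    then obtain e where "e > 0" "\<forall>q\<in>?M. tdist P q < e \<longrightarrow> rayleigh A P \<le> rayleigh A q"
      unfolding local_minimizer_def by blast
    then show thesis by (intro that[of "- 1" e]) auto
  qed
  have VH: "V \<in> her_prod ns" using iso(1) by (simp add: Gr_tangent_def)
  have "tinner (?H V) V = 0"
    using hessian_eq[OF A p rayleigh_diff_critical(1)[OF A p s e ext] lc tad_her_her[OF VH pH] iso(1)]
    unfolding tad_tad_tangent[OF p iso(1)] iso(2) by simp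
  then have "?H V = ?H (tadd (tscale 0 V) (tscale 0 V))"
    using hessian_kernel[OF A p s e ext lc iso(1)] by simp
  moreover have "inj_on ?H (Gr_tangent ns P)"
    using assms(9) unfolding nondegenerate_at_def tangent_space_Gr[OF p] by (rule bij_betw_imp_inj_on)
  ultimately have eq: "V = tadd (tscale 0 V) (tscale 0 V)"
    using iso(1) Gr_tangent_linear[OF p iso(1) iso(1)] by (simp add: inj_on_def)
  have Vj: "V ! j = W" using jl by (simp add: V_def)
  have "V ! j = tadd (tscale 0 V) (tscale 0 V) ! j" using eq by (rule arg_cong)
  also have "\<dots> = 0\<^sub>m (ns ! j) (ns ! j)"
    using Vj jl her_prod_length[OF VH] her_carrier[OF W(1)] by (auto intro!: eq_matI)
  finally show False using W(2) Vj by simp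
qed

end
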